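(* There exist finite Galois extensions of valued fields $\mathcal E=(L/K,v)$ for which $$\mathrm{depth}(\mathcal E)<\#\mathrm{Ram}(\mathcal E).$$
   Context: $v$ denotes a valuation on an algebraic closure $\overline K$ of $K$, restricted to all intermediate fields, written additively. Depth: for $\theta\in\overline K$ of degree $n=\deg_K\theta$, $\mathrm{depth}(\theta)$ is the length of any Mac Lane-Vaquié chain of the valuation $v_\theta(f)=v(f(\theta))$ on $K[x]$. Equivalently (known theorem), put $D_m=\{v(\theta-b)\mid b\in\overline K,\ [K(b):K]=m\}\subseteq v\overline K\cup\{\infty\}$; then $\mathrm{depth}(\theta)$ is the integer $s$ such that $1=m_0<m_1<\dots<m_s=n$, where $m_0=1$ and, as long as $m_{\ell-1}<n$, $m_\ell$ is the least integer $m>m_{\ell-1}$ for which some $\epsilon\in D_m$ is strictly larger than all elements of $D_{m_{\ell-1}}$. For a simple algebraic extension, $\mathrm{depth}(\mathcal E)=\min\{\mathrm{depth}(\theta)\mid L=K(\theta)\}$. Ramification: for $\mathcal E=(L/K,v)$ Galois and $\sigma\in\mathrm{Gal}(L/K)$, $I_\sigma=\{c\in L\mid vc\ge v\left(\frac{\sigma b-b}{b}\right)\text{ for some }b\in L^*\}$; for a subgroup $H$, $I_H=\bigcup_{\sigma\in H}I_\sigma$; and $\mathrm{Ram}(\mathcal E)=\{I_H\mid H\text{ a subgroup of }\mathrm{Gal}(L/K),\ H\ne\{\mathrm{id}\}\}$. *)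

theory Defs
  imports "HOL-Algebra.Algebraic_Closure" "HOL-Algebra.Generated_Fields" "HOL-Algebra.Bij"
    Complex_Main
begin

section \<open>Krull valuations\<close>

text \<open>
  The value group is an arbitrary linearly ordered abelian group. The literature writes it
  additively; here it appears in the multiplicative notation of the record \<open>monoid\<close>,
  so \<open>\<otimes>\<close> of the value group is the addition of values. Values live in the group
  together with \<open>\<infinity>\<close>, which is encoded as \<open>None\<close>.
\<close>

record 'g ordered_group = "'g monoid" +
  order_rel :: "'g rel"

locale linearly_ordered_comm_group = comm_group \<Gamma> for \<Gamma> :: "('g, 'm) ordered_group_scheme" (structure) +
  assumes linear: "linear_order_on (carrier \<Gamma>) (order_rel \<Gamma>)"
    and translation:
      "\<lbrakk> (g, h) \<in> order_rel \<Gamma>; k \<in> carrier \<Gamma> \<rbrakk> \<Longrightarrow> (g \<otimes> k, h \<otimes> k) \<in> order_rel \<Gamma>"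

fun val_add :: "('g, 'm) ordered_group_scheme \<Rightarrow> 'g option \<Rightarrow> 'g option \<Rightarrow> 'g option" where
  "val_add \<Gamma> (Some g) (Some h) = Some (g \<otimes>\<^bsub>\<Gamma>\<^esub> h)"
| "val_add \<Gamma> None _ = None"
| "val_add \<Gamma> _ None = None"

fun val_le :: "('g, 'm) ordered_group_scheme \<Rightarrow> 'g option \<Rightarrow> 'g option \<Rightarrow> bool" where
  "val_le \<Gamma> _ None \<longleftrightarrow> True"
| "val_le \<Gamma> None (Some h) \<longleftrightarrow> False"
| "val_le \<Gamma> (Some g) (Some h) \<longleftrightarrow> (g, h) \<in> order_rel \<Gamma>"

definition val_less :: "('g, 'm) ordered_group_scheme \<Rightarrow> 'g option \<Rightarrow> 'g option \<Rightarrow> bool" where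
  "val_less \<Gamma> \<alpha> \<beta> \<longleftrightarrow> val_le \<Gamma> \<alpha> \<beta> \<and> \<alpha> \<noteq> \<beta>"

text \<open>
  The last assumption says \<open>v (x \<oplus> y) \<ge> min (v x) (v y)\<close>, since values are linearly ordered.
\<close>

locale valuation =
  field A + value_group: linearly_ordered_comm_group \<Gamma>
  for A (structure) and \<Gamma> :: "('g, 'm) ordered_group_scheme" and v +
  assumes val_closed: "x \<in> carrier A \<Longrightarrow> v x \<in> insert None (Some ` carrier \<Gamma>)"
    and val_infinite_iff: "x \<in> carrier A \<Longrightarrow> v x = None \<longleftrightarrow> x = \<zero>"
    and val_mult: "\<lbrakk> x \<in> carrier A; y \<in> carrier A \<rbrakk> \<Longrightarrow> v (x \<otimes> y) = val_add \<Gamma> (v x) (v y)"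
    and val_ultrametric: "\<lbrakk> x \<in> carrier A; y \<in> carrier A \<rbrakk> \<Longrightarrow>
          val_le \<Gamma> (v x) (v (x \<oplus> y)) \<or> val_le \<Gamma> (v y) (v (x \<oplus> y))"


section \<open>Finite Galois extensions of valued fields\<close>

text \<open>
  Throughout, \<open>A\<close> is an algebraic closure of \<open>K\<close> carrying the valuation, and all
  intermediate fields, in particular \<open>L\<close>, are subfields of \<open>A\<close> with the restricted valuation.
  Fields and value groups have explicit carriers, so their element types are mere universes.
  The elements of the Galois group are extensional functions on \<open>L\<close>, so that equality of
  automorphisms of \<open>L\<close> is equality in HOL.
\<close>

definition Gal :: "('a, 'b) ring_scheme \<Rightarrow> 'a set \<Rightarrow> 'a set \<Rightarrow> ('a \<Rightarrow> 'a) monoid" where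
  "Gal A K L = BijGroup L
     \<lparr> carrier := {\<sigma> \<in> Bij L. \<sigma> \<in> ring_hom (A\<lparr>carrier := L\<rparr>) (A\<lparr>carrier := L\<rparr>) \<and>
                        (\<forall>x\<in>K. \<sigma> x = x)} \<rparr>"

locale finite_galois_valued_extension =
  algebraic_closure A K + valuation A \<Gamma> v
  for A (structure) and K and L and \<Gamma> :: "('g, 'm) ordered_group_scheme" and v +
  assumes subfield_L: "subfield L A"
    and K_subset_L: "K \<subseteq> L"
    and finite_extension: "ring.finite_dimension A K L"
    and fixed_field: "{x \<in> L. \<forall>\<sigma>\<in>carrier (Gal A K L). \<sigma> x = x} = K"


section \<open>Depth\<close>

abbreviation adjoin :: "('a, 'b) ring_scheme \<Rightarrow> 'a set \<Rightarrow> 'a \<Rightarrow> 'a set" where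
  "adjoin A K b \<equiv> generate_field A (insert b K)"

definition degree_over :: "('a, 'b) ring_scheme \<Rightarrow> 'a set \<Rightarrow> 'a \<Rightarrow> nat" where
  "degree_over A K b = ring.dim A K (adjoin A K b)"

definition distances ::
  "('a, 'b) ring_scheme \<Rightarrow> 'a set \<Rightarrow> ('a \<Rightarrow> 'g option) \<Rightarrow> 'a \<Rightarrow> nat \<Rightarrow> 'g option set" where
  "distances A K v \<theta> m = {v (\<theta> \<ominus>\<^bsub>A\<^esub> b) |b. b \<in> carrier A \<and> degree_over A K b = m}"

text \<open>
  The degrees \<open>m 0 < \<dots> < m s\<close> are those of the key polynomials in a Mac Lane-Vaquie chain of the
  valuation \<open>f \<mapsto> v (f \<theta>)\<close> on \<open>K[x]\<close>. They are read off from the sets of distances from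
  \<open>\<theta>\<close> to elements of a given degree. The least \<open>k\<close> below always exists as long as
  \<open>m i < degree_over A K \<theta>\<close>, because the distances of degree \<open>degree_over A K \<theta>\<close> contain
  \<open>\<infinity>\<close> and those of smaller degree do not.
\<close>

definition depth_degrees ::
  "('a, 'b) ring_scheme \<Rightarrow> 'a set \<Rightarrow> ('g, 'm) ordered_group_scheme \<Rightarrow> ('a \<Rightarrow> 'g option) \<Rightarrow>
     'a \<Rightarrow> nat \<Rightarrow> (nat \<Rightarrow> nat) \<Rightarrow> bool" where
  "depth_degrees A K \<Gamma> v \<theta> s m \<longleftrightarrow>
     m 0 = 1 \<and> m s = degree_over A K \<theta> \<and>
     (\<forall>i<s. m i < degree_over A K \<theta> \<and>
        m (Suc i) = (LEAST k. k > m i \<and>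
          (\<exists>\<epsilon>\<in>distances A K v \<theta> k. \<forall>\<delta>\<in>distances A K v \<theta> (m i). val_less \<Gamma> \<delta> \<epsilon>)))"

definition depth ::
  "('a, 'b) ring_scheme \<Rightarrow> 'a set \<Rightarrow> ('g, 'm) ordered_group_scheme \<Rightarrow> ('a \<Rightarrow> 'g option) \<Rightarrow>
     'a \<Rightarrow> nat" where
  "depth A K \<Gamma> v \<theta> = (THE s. \<exists>m. depth_degrees A K \<Gamma> v \<theta> s m)"

definition extension_depth ::
  "('a, 'b) ring_scheme \<Rightarrow> 'a set \<Rightarrow> 'a set \<Rightarrow> ('g, 'm) ordered_group_scheme \<Rightarrow>
     ('a \<Rightarrow> 'g option) \<Rightarrow> nat" where
  "extension_depth A K L \<Gamma> v =
     (LEAST s. \<exists>\<theta>\<in>carrier A. adjoin A K \<theta> = L \<and> depth A K \<Gamma> v \<theta> = s)"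


section \<open>Ramification ideals\<close>

definition ramification_set ::
  "('a, 'b) ring_scheme \<Rightarrow> 'a set \<Rightarrow> ('g, 'm) ordered_group_scheme \<Rightarrow> ('a \<Rightarrow> 'g option) \<Rightarrow>
     ('a \<Rightarrow> 'a) \<Rightarrow> 'a set" where
  "ramification_set A L \<Gamma> v \<sigma> =
     {c \<in> L. \<exists>b \<in> L - {\<zero>\<^bsub>A\<^esub>}. val_le \<Gamma> (v ((\<sigma> b \<ominus>\<^bsub>A\<^esub> b) \<otimes>\<^bsub>A\<^esub> inv\<^bsub>A\<^esub> b)) (v c)}"

definition ramification_ideal ::
  "('a, 'b) ring_scheme \<Rightarrow> 'a set \<Rightarrow> ('g, 'm) ordered_group_scheme \<Rightarrow> ('a \<Rightarrow> 'g option) \<Rightarrow>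
     ('a \<Rightarrow> 'a) set \<Rightarrow> 'a set" where
  "ramification_ideal A L \<Gamma> v H = (\<Union>\<sigma>\<in>H. ramification_set A L \<Gamma> v \<sigma>)"

definition Ram ::
  "('a, 'b) ring_scheme \<Rightarrow> 'a set \<Rightarrow> 'a set \<Rightarrow> ('g, 'm) ordered_group_scheme \<Rightarrow>
     ('a \<Rightarrow> 'g option) \<Rightarrow> 'a set set" where
  "Ram A K L \<Gamma> v =
     {ramification_ideal A L \<Gamma> v H |H. subgroup H (Gal A K L) \<and> H \<noteq> {\<one>\<^bsub>Gal A K L\<^esub>}}"

end

(* Let K = Q(i), let theta^4 = 1 + i, and let v extend the 2-adic valuation to the algebraic numbers.
   Since 1 + i generates the value group of K, the extension L = K(theta) is cyclic of degree 4 and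
   totally ramified. An element that is closer to theta than 0 has the value v(theta), which is of
   order 4 modulo v(K), so its degree is at least 4: the chain of degrees is 1, 4 and the depth
   is 1. On the other hand sigma(theta) = i theta has the quotient i - 1, of value v(2) / 2, whereas
   all quotients (tau b - b) / b of tau = sigma^2 have value at least v(2). Hence the subgroup
   generated by tau and the whole Galois group have different ramification ideals.
   The valuation is obtained from a subring of the complex numbers that is maximal among those
   not containing 1/2. *)
theory Submission
  imports Defs "HOL-Computational_Algebra.Fundamental_Theorem_Algebra"
begin

section \<open>Subrings and valuation rings\<close>

text \<open>Everything rests on one observation. If 4 v(t) = v(1 + i), the terms a_j t^j with j < 4
  and nonzero a_j in K have pairwise distinct values, so a polynomial of degree below 4 takes at t
  the least value among its terms. For t = theta this yields the degree, the well-definedness of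
  theta -> i theta, and the bound for tau; for elements near theta it bounds their degree. It
  thereby takes the place of an irreducibility criterion. No explicit 2-adic valuation occurs
  either: that 2 is a nonunit already makes odd integers units and fixes the values on K. Values are
  cosets of units, and inequalities between them are read as divisibility in the valuation ring,
  which covers infinite values as well. The field K contains i so that theta -> i theta is a
  substitution with coefficients in K. The two sides of the inequality are asymmetric. Extension
  depth is a minimum, so the one generator theta bounds it from above. Ramification ideals are
  counted by \<open>card\<close>, which is 0 on infinite sets, so finiteness has to be established
  along with two distinct ideals.\<close>

locale unital_subring =
  fixes R :: "'a::field set"
  assumes one_mem: "1 \<in> R"
    and diff_mem: "x \<in> R \<Longrightarrow> y \<in> R \<Longrightarrow> x - y \<in> R"
    and mult_mem: "x \<in> R \<Longrightarrow> y \<in> R \<Longrightarrow> x * y \<in> R"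
begin

lemma zero_mem: "0 \<in> R"
  using diff_mem[OF one_mem one_mem] by simp

lemma uminus_mem: "x \<in> R \<Longrightarrow> - x \<in> R"
  using diff_mem[OF zero_mem] by simp

lemma add_mem: "x \<in> R \<Longrightarrow> y \<in> R \<Longrightarrow> x + y \<in> R"
  using diff_mem[OF _ uminus_mem] by fastforce

lemma power_mem: "x \<in> R \<Longrightarrow> x ^ n \<in> R"
  by (induction n) (auto intro: one_mem mult_mem)

lemma sum_mem: "(\<And>i. i \<in> I \<Longrightarrow> f i \<in> R) \<Longrightarrow> sum f I \<in> R"
  by (induction I rule: infinite_finite_induct) (auto intro: zero_mem add_mem)

lemma of_nat_mem: "of_nat n \<in> R"
  by (induction n) (auto intro: one_mem add_mem zero_mem)

lemma of_int_mem: "of_int k \<in> R"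
  by (cases k rule: int_cases2) (auto intro: of_nat_mem uminus_mem)

definition polys :: "'a poly set" where
  "polys = {p. \<forall>i. coeff p i \<in> R}"

lemma coeff_polys: "p \<in> polys \<Longrightarrow> coeff p i \<in> R"
  by (simp add: polys_def)

lemma pCons_polys: "pCons a p \<in> polys \<longleftrightarrow> a \<in> R \<and> p \<in> polys"
  unfolding polys_def by (auto simp: coeff_pCons split: nat.splits)

lemma zero_polys: "0 \<in> polys"
  by (simp add: polys_def zero_mem)

lemma const_polys: "a \<in> R \<Longrightarrow> [:a:] \<in> polys"
  by (simp add: pCons_polys zero_polys)

lemma add_polys: "p \<in> polys \<Longrightarrow> q \<in> polys \<Longrightarrow> p + q \<in> polys"
  by (simp add: polys_def add_mem)

lemma diff_polys: "p \<in> polys \<Longrightarrow> q \<in> polys \<Longrightarrow> p - q \<in> polys"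
  by (simp add: polys_def diff_mem)

lemma mult_polys: "p \<in> polys \<Longrightarrow> q \<in> polys \<Longrightarrow> p * q \<in> polys"
  by (simp add: polys_def coeff_mult sum_mem mult_mem)

text \<open>This substitution turns a value at \<open>c * t\<close> into a value at
  \<open>t\<close>; multiplication of \<open>\<theta>\<close> by a root of unity will act through
  it.\<close>

lemma scale_polys: "p \<in> polys \<Longrightarrow> c \<in> R \<Longrightarrow> p \<circ>\<^sub>p [:0, c:] \<in> polys"
  by (simp add: polys_def coeff_pcompose_linear power_mem mult_mem)

text \<open>The ring R[x], described by polynomial values so that the degree of a representing
  polynomial can be minimized.\<close>

definition adjunction :: "'a \<Rightarrow> 'a set" where
  "adjunction x = {poly p x | p. p \<in> polys}"

lemma adjunctionI: "p \<in> polys \<Longrightarrow> y = poly p x \<Longrightarrow> y \<in> adjunction x"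
  by (auto simp: adjunction_def)

lemma base_subset_adjunction: "R \<subseteq> adjunction x"
  by (auto intro!: adjunctionI const_polys)

lemma gen_mem_adjunction: "x \<in> adjunction x"
  by (rule adjunctionI[of "[:0, 1:]"]) (auto simp: pCons_polys zero_polys zero_mem one_mem)

lemma adjunction_subring: "unital_subring (adjunction x)"
proof
  show "1 \<in> adjunction x"
    using base_subset_adjunction one_mem by blast
next
  fix y z assume "y \<in> adjunction x" "z \<in> adjunction x"
  then obtain p q where "p \<in> polys" "y = poly p x" "q \<in> polys" "z = poly q x"
    by (auto simp: adjunction_def)
  then show "y - z \<in> adjunction x" "y * z \<in> adjunction x"
    by (auto intro: adjunctionI[OF diff_polys] adjunctionI[OF mult_polys])
qed

end

lemma unital_subring_Ints: "unital_subring (\<int> :: 'a::field set)"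
  by unfold_locales auto

locale valuation_ring = unital_subring V for V :: "'a::field set" +
  assumes mem_or_inverse_mem: "x \<in> V \<or> inverse x \<in> V"

section \<open>Subrings maximal without a given inverse are valuation rings\<close>

locale maximal_subring = unital_subring V for V :: "'a::field set" +
  fixes c :: 'a
  assumes c_mem: "c \<in> V" and inverse_c: "inverse c \<notin> V"
    and maximal: "unital_subring W \<Longrightarrow> V \<subseteq> W \<Longrightarrow> inverse c \<notin> W \<Longrightarrow> W = V"
begin

lemma c_nonzero: "c \<noteq> 0"
  using inverse_c zero_mem by auto

lemma inverse_c_mem_adjunction: "x \<notin> V \<Longrightarrow> inverse c \<in> adjunction x"
  using maximal[OF adjunction_subring base_subset_adjunction] gen_mem_adjunction by metis

text \<open>Elements of the form \<open>1 - c * a\<close> are closed under products: every cross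
  term keeps a factor \<open>c\<close>.\<close>

lemma one_minus_power: "a \<in> V \<Longrightarrow> \<exists>b\<in>V. (1 - c * a) ^ n = 1 - c * b"
proof (induction n)
  case 0
  then show ?case using zero_mem by (auto intro!: bexI[of _ 0])
next
  case (Suc n)
  then obtain b where b: "b \<in> V" "(1 - c * a) ^ n = 1 - c * b" by auto
  have "(1 - c * a) ^ Suc n = 1 - c * (a + b - c * (a * b))"
    unfolding power_Suc b(2) by (simp add: algebra_simps)
  moreover have "a + b - c * (a * b) \<in> V"
    using b Suc.prems c_mem by (intro diff_mem add_mem mult_mem) auto
  ultimately show ?case by blast
qed

lemma one_minus_nonzero: "a \<in> V \<Longrightarrow> 1 - c * a \<noteq> 0"
  using inverse_c by (metis eq_iff_diff_eq_0 inverse_unique)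

text \<open>Otherwise maximality makes \<open>1 / c\<close> a polynomial in the inverse of
  \<open>u = 1 - c * a\<close>. Multiplying by \<open>u ^ n\<close> clears the denominators, and
  since \<open>u ^ n = 1 - c * b\<close>, the element \<open>1 / c\<close> itself would lie in
  \<open>V\<close>.\<close>

lemma inverse_one_minus:
  assumes a: "a \<in> V"
  shows "inverse (1 - c * a) \<in> V"
proof (rule ccontr)
  let ?u = "1 - c * a"
  assume "inverse ?u \<notin> V"
  then obtain p where p: "p \<in> polys" "inverse c = poly p (inverse ?u)"
    using inverse_c_mem_adjunction by (auto simp: adjunction_def)
  have u: "?u \<noteq> 0" "?u \<in> V"
    using one_minus_nonzero[OF a] a c_mem by (auto intro: diff_mem one_mem mult_mem)
  define n where "n = degree p"
  have "?u ^ n * inverse c = (\<Sum>i\<le>n. coeff p i * ?u ^ (n - i))"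
    unfolding p(2) poly_altdef n_def[symmetric] sum_distrib_left
    using u(1) by (intro sum.cong) (auto simp: field_simps power_diff)
  also have "\<dots> \<in> V"
    using coeff_polys[OF p(1)] u(2) by (intro sum_mem mult_mem power_mem)
  finally have *: "?u ^ n * inverse c \<in> V" .
  obtain b where "b \<in> V" "?u ^ n = 1 - c * b"
    using one_minus_power[OF a] by blast
  then have "inverse c = ?u ^ n * inverse c + b"
    using c_nonzero by (simp add: field_simps)
  then show False
    using add_mem[OF * \<open>b \<in> V\<close>] inverse_c by simp
qed

text \<open>A relation of degree \<open>m \<le> n\<close> in \<open>1 / x\<close> makes \<open>x ^ n\<close> a \<open>c\<close>-multiple of a combination of
  lower powers, because \<open>1 - c * b\<close> is a unit.\<close>

lemma lower_degree:
  assumes p: "p \<in> polys" "degree p \<le> n" "inverse c = poly p x"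
    and q: "q \<in> polys" "degree q \<le> n" "inverse c = poly q (inverse x)"
    and x: "x \<noteq> 0"
  shows "\<exists>r\<in>polys. degree r < n \<and> inverse c = poly r x"
proof -
  have n: "n > 0"
  proof (rule ccontr)
    assume "\<not> n > 0"
    then have "degree p = 0" using p(2) by simp
    then have "inverse c = coeff p 0" using p(3) by (simp add: poly_altdef)
    then show False using coeff_polys[OF p(1), of 0] inverse_c by simp
  qed
  define u where "u = 1 - c * coeff q 0"
  have u: "u \<noteq> 0" "inverse u \<in> V"
    using one_minus_nonzero inverse_one_minus coeff_polys[OF q(1)] by (auto simp: u_def)
  have sum_n: "poly p x = (\<Sum>i\<le>n. coeff p i * x ^ i)"
    "poly q (inverse x) = (\<Sum>i\<le>n. coeff q i * inverse x ^ i)"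
    using p(2) q(2) by (auto simp: poly_altdef intro!: sum.mono_neutral_left le_degree)
  have "x ^ n = c * (\<Sum>i\<le>n. coeff q i * x ^ (n - i))"
  proof -
    have "x ^ n * inverse c = (\<Sum>i\<le>n. coeff q i * x ^ (n - i))"
      unfolding q(3) sum_n sum_distrib_left
      using x by (intro sum.cong) (auto simp: field_simps power_diff)
    then show ?thesis using c_nonzero by (simp add: field_simps)
  qed
  also have "(\<Sum>i\<le>n. coeff q i * x ^ (n - i)) =
      coeff q 0 * x ^ n + (\<Sum>i=1..n. coeff q i * x ^ (n - i))"
    by (simp add: atMost_atLeast0 sum.atLeast_Suc_atMost)
  finally have "u * x ^ n = c * (\<Sum>i=1..n. coeff q i * x ^ (n - i))"
    by (simp add: u_def algebra_simps)
  then have xn: "x ^ n = c * inverse u * (\<Sum>i=1..n. coeff q i * x ^ (n - i))"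
    using u(1) by (simp add: field_simps)
  define r where "r = (\<Sum>i<n. monom (coeff p i) i) +
    (\<Sum>i=1..n. monom (coeff p n * (c * inverse u) * coeff q i) (n - i))"
  have "poly r x = (\<Sum>i<n. coeff p i * x ^ i) + coeff p n * x ^ n"
    unfolding r_def xn by (simp add: poly_sum poly_monom sum_distrib_left mult.assoc)
  also have "\<dots> = poly p x"
    unfolding sum_n by (simp add: lessThan_Suc_atMost[symmetric])
  finally have "inverse c = poly r x" using p(3) by simp
  moreover have "degree r < n"
    unfolding r_def using n
    by (intro degree_add_less degree_sum_less order.strict_trans1[OF degree_monom_le]) auto
  moreover have "r \<in> polys"
    using coeff_polys[OF p(1)] coeff_polys[OF q(1)] u(2) c_mem
    unfolding polys_def r_def by (auto simp: coeff_sum intro!: add_mem sum_mem mult_mem zero_mem)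
  ultimately show ?thesis by blast
qed

text \<open>If \<open>x\<close> and \<open>1 / x\<close> are both missing, \<open>1 / c\<close> is a
  polynomial in each of them. With both degrees minimal, \<open>lower_degree\<close> would still
  reduce the larger one.\<close>

sublocale valuation_ring V
proof
  fix x
  show "x \<in> V \<or> inverse x \<in> V"
  proof (rule ccontr)
    assume "\<not> (x \<in> V \<or> inverse x \<in> V)"
    then have ex: "\<exists>p\<in>polys. inverse c = poly p x" "\<exists>p\<in>polys. inverse c = poly p (inverse x)"
      and x: "x \<noteq> 0" "inverse x \<noteq> 0"
      using inverse_c_mem_adjunction zero_mem by (auto simp: adjunction_def)
    define D where "D y n \<longleftrightarrow> (\<exists>p\<in>polys. degree p = n \<and> inverse c = poly p y)" for y n
    define m where "m y = (LEAST n. D y n)" for y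
    have D: "D x (m x)" "D (inverse x) (m (inverse x))"
      unfolding m_def by (rule LeastI_ex, use ex in \<open>simp add: D_def Bex_def; metis\<close>)+
    have least: "m y \<le> n" if "D y n" for y n
      unfolding m_def by (rule Least_le) (fact that)
    \<comment> \<open>Stated for an arbitrary \<open>y\<close> so that it serves whichever of
      \<open>x\<close> and \<open>1 / x\<close> needs the larger degree.\<close>
    have False if xy: "D y (m y)" "D (inverse y) (m (inverse y))" "m (inverse y) \<le> m y"
      "y \<noteq> 0" for y
    proof -
      have "\<exists>r\<in>polys. degree r < m y \<and> inverse c = poly r y"
        using xy unfolding D_def by (auto intro: lower_degree)
      then show False using least[of y] by (force simp: D_def)
    qed
    from this[of x] this[of "inverse x"] D x show False
      by (cases "m (inverse x) \<le> m x") auto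
  qed
qed

end

text \<open>By Zorn's lemma, a union of a chain of subrings avoiding \<open>1 / c\<close> avoids it
  too. This plays the part of the extension theorem for valuations: the valuation is built at once
  on the whole field.\<close>

theorem exists_valuation_ring:
  assumes "unital_subring R" "c \<in> R" "inverse c \<notin> R"
  obtains V where "valuation_ring V" "R \<subseteq> V" "inverse c \<notin> V"
proof -
  let ?F = "{W. unital_subring W \<and> R \<subseteq> W \<and> inverse c \<notin> W}"
  have "\<exists>V\<in>?F. \<forall>W\<in>?F. V \<subseteq> W \<longrightarrow> W = V"
  proof (rule subset_Zorn_nonempty)
    show "?F \<noteq> {}" using assms by blast
  next
    fix C assume C: "C \<noteq> {}" "subset.chain ?F C"
    then have sub: "\<And>W. W \<in> C \<Longrightarrow> unital_subring W \<and> R \<subseteq> W \<and> inverse c \<notin> W"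
      and chain: "\<And>W W'. W \<in> C \<Longrightarrow> W' \<in> C \<Longrightarrow> W \<subseteq> W' \<or> W' \<subseteq> W"
      by (auto simp: subset_chain_def)
    have "unital_subring (\<Union>C)"
    proof
      show "1 \<in> \<Union>C" using C(1) sub unital_subring.one_mem by blast
    next
      fix x y assume "x \<in> \<Union>C" "y \<in> \<Union>C"
      then obtain W where "W \<in> C" "x \<in> W" "y \<in> W" using chain by blast
      then show "x - y \<in> \<Union>C" "x * y \<in> \<Union>C"
        using sub unital_subring.diff_mem unital_subring.mult_mem by blast+
    qed
    then show "\<Union>C \<in> ?F" using C(1) sub by blast
  qed
  then obtain V where V: "unital_subring V" "R \<subseteq> V" "inverse c \<notin> V"
    and max: "\<And>W. unital_subring W \<Longrightarrow> R \<subseteq> W \<Longrightarrow> inverse c \<notin> W \<Longrightarrow> V \<subseteq> W \<Longrightarrow> W = V"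
    by auto
  interpret unital_subring V by fact
  interpret maximal_subring V c
    by unfold_locales (use V assms max in auto)
  show thesis using that valuation_ring_axioms V by blast
qed

section \<open>Units of a valuation ring and sums of terms with distinct values\<close>

context valuation_ring
begin

definition units :: "'a set" where
  "units = {u \<in> V. u \<noteq> 0 \<and> inverse u \<in> V}"

lemma units_mem: "u \<in> units \<Longrightarrow> u \<in> V" and units_nonzero: "u \<in> units \<Longrightarrow> u \<noteq> 0"
  by (auto simp: units_def)

lemma one_units: "1 \<in> units"
  by (simp add: units_def one_mem)

lemma mult_units: "u \<in> units \<Longrightarrow> w \<in> units \<Longrightarrow> u * w \<in> units"
  by (auto simp: units_def mult_mem)

lemma inverse_units: "u \<in> units \<Longrightarrow> inverse u \<in> units"
  by (auto simp: units_def)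

lemma divide_units: "u \<in> units \<Longrightarrow> w \<in> units \<Longrightarrow> u / w \<in> units"
  by (simp add: divide_inverse mult_units inverse_units)

lemma power_units: "u \<in> units \<Longrightarrow> u ^ n \<in> units"
  by (induction n) (auto simp: one_units mult_units)

lemma mult_units_cancel: "x \<in> V \<Longrightarrow> y \<in> V \<Longrightarrow> x * y \<in> units \<Longrightarrow> x \<in> units"
proof -
  assume xy: "x \<in> V" "y \<in> V" "x * y \<in> units"
  then have nz: "x \<noteq> 0" "y \<noteq> 0" using units_nonzero by fastforce+
  then have "inverse x = y * inverse (x * y)" by (simp add: field_simps)
  then have "inverse x \<in> V" using xy by (metis mult_mem inverse_units units_mem)
  with xy nz show ?thesis by (simp add: units_def)
qed

text \<open>Valuation rings are local: one of \<open>x\<close>, \<open>y\<close> divides the other,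
  hence divides the sum, and a divisor of a unit is a unit.\<close>

lemma add_units_cases:
  assumes "x \<in> V" "y \<in> V" "x + y \<in> units"
  shows "x \<in> units \<or> y \<in> units"
proof -
  have *: "y \<in> units" if xy: "x \<in> V" "y \<in> V" "x + y \<in> units" "x / y \<in> V" "y \<noteq> 0" for x y
  proof -
    have "x + y = y * (x / y + 1)" using xy by (simp add: field_simps)
    then show ?thesis
      using mult_units_cancel[of y "x / y + 1"] xy by (simp add: add_mem one_mem)
  qed
  show ?thesis
    using mem_or_inverse_mem[of "x / y"] *[of x y] *[of y x] assms
    by (cases "x = 0 \<or> y = 0") (auto simp: add.commute)
qed

lemma units_add_nonunit:
  assumes "u \<in> units" "x \<in> V" "x \<notin> units"
  shows "u + x \<in> units"
  using add_units_cases[of "u + x" "- x"] assms mult_units_cancel[of x "- 1"]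
  by (auto simp: units_mem add_mem uminus_mem one_mem)

lemma quotient_mem_cases:
  assumes "x \<noteq> 0" "y \<noteq> 0" "x / y \<notin> units"
  shows "x / y \<in> V \<and> x / y \<notin> units \<or> y / x \<in> V \<and> y / x \<notin> units"
  using mem_or_inverse_mem[of "x / y"] inverse_units[of "y / x"] assms by auto

text \<open>That \<open>f i / f j\<close> is no unit means that the two values differ. In the
  induction the new term is compared with the dominant term so far; the one of smaller value
  dominates the enlarged sum.\<close>

lemma sum_dominant:
  assumes "finite I" "I \<noteq> {}" "\<And>i. i \<in> I \<Longrightarrow> f i \<noteq> 0"
    and "\<And>i j. i \<in> I \<Longrightarrow> j \<in> I \<Longrightarrow> i \<noteq> j \<Longrightarrow> f i / f j \<notin> units"
  shows "\<exists>m\<in>I. sum f I / f m \<in> units \<and> (\<forall>i\<in>I. f i / f m \<in> V)"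
  using assms
proof (induction I rule: finite_ne_induct)
  case (singleton x)
  then show ?case by (auto simp: one_units one_mem)
next
  case (insert x I)
  then obtain m where m: "m \<in> I" "sum f I / f m \<in> units" "\<forall>i\<in>I. f i / f m \<in> V"
    by auto
  have nz: "f x \<noteq> 0" "f m \<noteq> 0" and ne: "f x / f m \<notin> units"
    using insert m(1) by auto
  from quotient_mem_cases[OF nz ne] show ?case
  proof
    assume *: "f x / f m \<in> V \<and> f x / f m \<notin> units"
    have "sum f (insert x I) / f m = sum f I / f m + f x / f m"
      using insert by (simp add: add_divide_distrib)
    then show ?thesis
      using * m units_add_nonunit by (intro bexI[of _ m]) auto
  next
    assume *: "f m / f x \<in> V \<and> f m / f x \<notin> units"
    have "(sum f I / f m) * (f m / f x) \<notin> units"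
      using * m(2) mult_units_cancel[of "f m / f x" "sum f I / f m"]
      by (auto simp: units_mem mult.commute)
    then have "1 + (sum f I / f m) * (f m / f x) \<in> units"
      using * m(2) by (intro units_add_nonunit one_units mult_mem) (auto simp: units_mem)
    moreover have "sum f (insert x I) / f x = 1 + (sum f I / f m) * (f m / f x)"
      using insert nz by (simp add: add_divide_distrib)
    moreover have "f i / f x \<in> V" if "i \<in> I" for i
      using mult_mem[of "f i / f m" "f m / f x"] m(3) that * nz by auto
    ultimately show ?thesis
      using nz one_mem by (intro bexI[of _ x]) auto
  qed
qed

text \<open>The least value is attained once, so the sum has that value and divides every term.
  Divisibility also covers a vanishing sum, where it forces all terms to be 0: linear independence
  is a special case.\<close>

lemma term_mem_multiples_of_sum:
  assumes "finite I" "i \<in> I"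
    and "\<And>i j. i \<in> I \<Longrightarrow> j \<in> I \<Longrightarrow> i \<noteq> j \<Longrightarrow> f i \<noteq> 0 \<Longrightarrow> f j \<noteq> 0 \<Longrightarrow> f i / f j \<notin> units"
  shows "\<exists>c\<in>V. f i = c * sum f I"
proof (cases "f i = 0")
  case True
  then show ?thesis using zero_mem by (auto intro: bexI[of _ 0])
next
  case False
  define J where "J = {i \<in> I. f i \<noteq> 0}"
  have sum_J: "sum f J = sum f I"
    unfolding J_def using assms(1) by (intro sum.mono_neutral_left) auto
  obtain m where m: "m \<in> J" "sum f J / f m \<in> units" "\<forall>i\<in>J. f i / f m \<in> V"
  proof -
    have "finite J" "J \<noteq> {}" using assms(1,2) False by (auto simp: J_def)
    moreover have "f i \<noteq> 0" if "i \<in> J" for i using that by (simp add: J_def)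
    moreover have "f i / f j \<notin> units" if "i \<in> J" "j \<in> J" "i \<noteq> j" for i j
      using that assms(3) unfolding J_def by blast
    ultimately show ?thesis using sum_dominant[of J f] that by blast
  qed
  have nz: "f i \<noteq> 0" "f m \<noteq> 0" "sum f J \<noteq> 0" and i: "i \<in> J"
    using m(1) False assms(2) units_nonzero[OF m(2)] by (auto simp: J_def)
  show ?thesis
  proof
    show "f i / f m * inverse (sum f J / f m) \<in> V"
      using m(3) i units_mem[OF inverse_units[OF m(2)]] by (blast intro: mult_mem)
    show "f i = f i / f m * inverse (sum f J / f m) * sum f I"
      using nz by (simp add: sum_J[symmetric])
  qed
qed

end

section \<open>The value group of a valuation ring\<close>

text \<open>A bridge from type class fields, where the arithmetic takes place, to the records with
  explicit carrier that the valued extension requires.\<close>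

definition field_on :: "'a::field set \<Rightarrow> 'a ring" where
  "field_on F = \<lparr>carrier = F, monoid.mult = (*), one = 1, zero = 0, add = (+)\<rparr>"

lemma field_on_simps [simp]:
  "carrier (field_on F) = F" "monoid.mult (field_on F) = (*)" "one (field_on F) = 1"
  "zero (field_on F) = 0" "add (field_on F) = (+)"
  "field_on F \<lparr>carrier := E\<rparr> = field_on E"
  by (simp_all add: field_on_def)

section \<open>Subfields of a type class field as records\<close>

locale unital_subfield = unital_subring F for F :: "'a::field set" +
  assumes inverse_mem: "x \<in> F \<Longrightarrow> inverse x \<in> F"
begin

lemma divide_mem: "x \<in> F \<Longrightarrow> y \<in> F \<Longrightarrow> x / y \<in> F"
  by (simp add: divide_inverse inverse_mem mult_mem)

lemma field_field_on: "field (field_on F)"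
proof (rule cring.cring_fieldI2)
  show "cring (field_on F)"
  proof (rule cringI)
    show "abelian_group (field_on F)"
    proof (rule abelian_groupI)
      fix x assume "x \<in> carrier (field_on F)"
      then show "\<exists>y\<in>carrier (field_on F). y \<oplus>\<^bsub>field_on F\<^esub> x = \<zero>\<^bsub>field_on F\<^esub>"
        by (auto intro!: bexI[of _ "- x"] uminus_mem)
    qed (auto simp: add_mem zero_mem)
    show "comm_monoid (field_on F)"
      by (rule comm_monoidI) (auto simp: mult_mem one_mem)
  qed (simp add: algebra_simps)
next
  fix a assume "a \<in> carrier (field_on F)" "a \<noteq> \<zero>\<^bsub>field_on F\<^esub>"
  then show "\<exists>b\<in>carrier (field_on F). a \<otimes>\<^bsub>field_on F\<^esub> b = \<one>\<^bsub>field_on F\<^esub>"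
    by (auto intro!: bexI[of _ "inverse a"] simp: inverse_mem)
qed simp

interpretation field "field_on F"
  by (rule field_field_on)

lemma a_inv_field_on: "x \<in> F \<Longrightarrow> \<ominus>\<^bsub>field_on F\<^esub> x = - x"
  using minus_equality[of "- x" x] by (simp add: uminus_mem)

lemma a_minus_field_on: "x \<in> F \<Longrightarrow> y \<in> F \<Longrightarrow> x \<ominus>\<^bsub>field_on F\<^esub> y = x - y"
  by (simp add: a_minus_def a_inv_field_on)

lemma m_inv_field_on: "x \<in> F \<Longrightarrow> x \<noteq> 0 \<Longrightarrow> inv\<^bsub>field_on F\<^esub> x = inverse x"
  using comm_inv_char[of x "inverse x"] by (simp add: inverse_mem)

lemma subfield_field_on:
  assumes "unital_subfield E" "E \<subseteq> F"
  shows "subfield E (field_on F)"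
  using subfield_iff(1)[of E] unital_subfield.field_field_on[OF assms(1)] assms(2) by simp

end

lemma unital_subfield_of_subfield:
  assumes "unital_subfield F" "subfield E (field_on F)"
  shows "unital_subfield E"
proof -
  interpret F: unital_subfield F by fact
  interpret field "field_on F" by (rule F.field_field_on)
  note E = subringE[OF subfieldE(1)[OF assms(2)]]
  have sub: "x \<in> F" if "x \<in> E" for x using E(1) that by auto
  show ?thesis
  proof
    show "1 \<in> E" using E(3) by simp
  next
    fix x y assume xy: "x \<in> E" "y \<in> E"
    show "x * y \<in> E" using E(6)[OF xy] by simp
    have "- y \<in> E" using E(5)[OF xy(2)] sub[OF xy(2)] by (simp add: F.a_inv_field_on)
    from E(7)[OF xy(1) this] show "x - y \<in> E" by simp
  next
    fix x assume x: "x \<in> E"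
    show "inverse x \<in> E"
    proof (cases "x = 0")
      case True then show ?thesis using x by simp
    next
      case False
      then show ?thesis
        using subfield_m_inv(1)[OF assms(2), of x] x sub[OF x] F.m_inv_field_on[of x] by simp
    qed
  qed
qed

context valuation_ring
begin

definition unit_coset :: "'a \<Rightarrow> 'a set" where
  "unit_coset x = (\<lambda>u. u * x) ` units"

text \<open>The multiplicative group modulo the units, ordered by divisibility in \<open>V\<close>:
  larger values belong to multiples. Classes of all nonzero elements of the type are taken, so one
  group serves every subfield.\<close>

definition value_group :: "'a set ordered_group" where
  "value_group =
     \<lparr>carrier = unit_coset ` (- {0}),
      monoid.mult = (\<lambda>S T. {s * t | s t. s \<in> S \<and> t \<in> T}), one = units,
      order_rel = {(unit_coset x, unit_coset y) | x y. x \<noteq> 0 \<and> y \<noteq> 0 \<and> y / x \<in> V}\<rparr>"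

definition val :: "'a \<Rightarrow> 'a set option" where
  "val x = (if x = 0 then None else Some (unit_coset x))"

lemma mem_unit_coset: "x \<noteq> 0 \<Longrightarrow> y \<in> unit_coset x \<longleftrightarrow> y / x \<in> units"
  by (auto simp: unit_coset_def image_iff intro!: bexI[of _ "y / x"])

lemma unit_coset_eq_iff:
  assumes "x \<noteq> 0" "y \<noteq> 0"
  shows "unit_coset x = unit_coset y \<longleftrightarrow> x / y \<in> units"
proof
  assume "unit_coset x = unit_coset y"
  moreover have "x \<in> unit_coset x" using assms by (simp add: mem_unit_coset one_units)
  ultimately show "x / y \<in> units" using assms by (simp add: mem_unit_coset)
next
  assume *: "x / y \<in> units"
  show "unit_coset x = unit_coset y"
  proof (intro Set.set_eqI)
    fix z
    have "z / x = (z / y) / (x / y)" "z / y = (z / x) * (x / y)" using assms by auto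
    then show "z \<in> unit_coset x \<longleftrightarrow> z \<in> unit_coset y"
      using * assms by (metis mem_unit_coset mult_units divide_units)
  qed
qed

lemma unit_coset_mult: "x \<noteq> 0 \<Longrightarrow> y \<noteq> 0 \<Longrightarrow>
    unit_coset x \<otimes>\<^bsub>value_group\<^esub> unit_coset y = unit_coset (x * y)"
  unfolding value_group_def
proof (simp, intro Set.set_eqI iffI)
  fix z assume xy: "x \<noteq> 0" "y \<noteq> 0" and z: "z \<in> unit_coset (x * y)"
  then obtain u where "u \<in> units" "z = (u * x) * y"
    by (auto simp: unit_coset_def)
  moreover have "u * x \<in> unit_coset x" if "u \<in> units" for u
    using that unfolding unit_coset_def by blast
  moreover have "y \<in> unit_coset y" using xy by (simp add: mem_unit_coset one_units)
  ultimately show "z \<in> {s * t | s t. s \<in> unit_coset x \<and> t \<in> unit_coset y}" by blast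
next
  fix z assume "z \<in> {s * t | s t. s \<in> unit_coset x \<and> t \<in> unit_coset y}"
  then obtain u w where "u \<in> units" "w \<in> units" "z = (u * x) * (w * y)"
    by (auto simp: unit_coset_def)
  then show "z \<in> unit_coset (x * y)"
    by (auto simp: unit_coset_def image_iff mult_units intro!: bexI[of _ "u * w"])
qed

lemma unit_coset_one: "unit_coset 1 = \<one>\<^bsub>value_group\<^esub>"
  by (simp add: unit_coset_def value_group_def)

text \<open>Independence of representatives: changing them multiplies the quotient by units.\<close>

lemma order_rel_value_group:
  assumes "x \<noteq> 0" "y \<noteq> 0"
  shows "(unit_coset x, unit_coset y) \<in> order_rel value_group \<longleftrightarrow> y / x \<in> V"
proof
  assume "(unit_coset x, unit_coset y) \<in> order_rel value_group"
  then obtain x' y' where *: "x' \<noteq> 0" "y' \<noteq> 0" "y' / x' \<in> V"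
    "unit_coset x = unit_coset x'" "unit_coset y = unit_coset y'"
    by (auto simp: value_group_def)
  have "y / x = (y / y') * (x' / x) * (y' / x')" using * assms by simp
  moreover have "y / y' \<in> V" "x' / x \<in> V"
    using * assms unit_coset_eq_iff units_mem by metis+
  ultimately show "y / x \<in> V" using *(3) mult_mem by metis
qed (use assms in \<open>auto simp: value_group_def\<close>)

lemma carrier_value_group: "g \<in> carrier value_group \<longleftrightarrow> (\<exists>x. x \<noteq> 0 \<and> g = unit_coset x)"
  by (auto simp: value_group_def)

lemma unit_coset_carrier: "x \<noteq> 0 \<Longrightarrow> unit_coset x \<in> carrier value_group"
  by (auto simp: carrier_value_group)

lemma quotient_units: "x \<noteq> 0 \<Longrightarrow> y \<noteq> 0 \<Longrightarrow> x / y \<in> V \<Longrightarrow> y / x \<in> V \<Longrightarrow> x / y \<in> units"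
  by (simp add: units_def)

lemma linearly_ordered_value_group: "linearly_ordered_comm_group value_group"
proof -
  have "comm_group value_group"
  proof (rule comm_groupI)
    fix g assume "g \<in> carrier value_group"
    then obtain x where "x \<noteq> 0" "g = unit_coset x" by (auto simp: carrier_value_group)
    then show "\<exists>h\<in>carrier value_group. h \<otimes>\<^bsub>value_group\<^esub> g = \<one>\<^bsub>value_group\<^esub>"
      by (intro bexI[of _ "unit_coset (inverse x)"])
        (auto simp: unit_coset_mult unit_coset_one[symmetric] intro!: unit_coset_carrier)
  qed (auto simp: carrier_value_group unit_coset_mult unit_coset_one[symmetric] mult_ac
        intro!: unit_coset_carrier[unfolded carrier_value_group])
  then interpret comm_group value_group .
  have rel: "(g, h) \<in> order_rel value_group \<Longrightarrow>
      \<exists>x y. x \<noteq> 0 \<and> y \<noteq> 0 \<and> g = unit_coset x \<and> h = unit_coset y \<and> y / x \<in> V" for g h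
    by (auto simp: value_group_def)
  show ?thesis
  proof
    show "linear_order_on (carrier value_group) (order_rel value_group)"
      unfolding linear_order_on_def partial_order_on_def preorder_on_def
    proof (intro conjI)
      show "order_rel value_group \<subseteq> carrier value_group \<times> carrier value_group"
        by (auto simp: value_group_def)
      show "refl_on (carrier value_group) (order_rel value_group)"
        by (auto simp: refl_on_def carrier_value_group order_rel_value_group one_mem)
      show "trans (order_rel value_group)"
      proof (rule transI)
        fix g h k assume *: "(g, h) \<in> order_rel value_group" "(h, k) \<in> order_rel value_group"
        obtain x y z where xyz: "x \<noteq> 0" "y \<noteq> 0" "z \<noteq> 0"
          "g = unit_coset x" "h = unit_coset y" "k = unit_coset z"
          using rel[OF *(1)] rel[OF *(2)] by blast
        then have "z / x = (z / y) * (y / x)" by simp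
        then show "(g, k) \<in> order_rel value_group"
          using * xyz by (metis order_rel_value_group mult_mem)
      qed
      show "antisym (order_rel value_group)"
      proof (rule antisymI)
        fix g h assume *: "(g, h) \<in> order_rel value_group" "(h, g) \<in> order_rel value_group"
        obtain x y where xy: "x \<noteq> 0" "y \<noteq> 0" "g = unit_coset x" "h = unit_coset y"
          using rel[OF *(1)] by blast
        with * show "g = h"
          by (simp add: order_rel_value_group unit_coset_eq_iff quotient_units)
      qed
      show "total_on (carrier value_group) (order_rel value_group)"
      proof (rule total_onI)
        fix g h assume "g \<in> carrier value_group" "h \<in> carrier value_group"
        then obtain x y where "x \<noteq> 0" "y \<noteq> 0" "g = unit_coset x" "h = unit_coset y"
          by (auto simp: carrier_value_group)
        then show "(g, h) \<in> order_rel value_group \<or> (h, g) \<in> order_rel value_group"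
          using mem_or_inverse_mem[of "y / x"] by (simp add: order_rel_value_group)
      qed
    qed
  next
    fix g h k assume *: "(g, h) \<in> order_rel value_group" "k \<in> carrier value_group"
    obtain x y z where "x \<noteq> 0" "y \<noteq> 0" "z \<noteq> 0" "y / x \<in> V"
      "g = unit_coset x" "h = unit_coset y" "k = unit_coset z"
      using rel[OF *(1)] *(2) by (auto simp: carrier_value_group)
    then show "(g \<otimes>\<^bsub>value_group\<^esub> k, h \<otimes>\<^bsub>value_group\<^esub> k) \<in> order_rel value_group"
      by (simp add: unit_coset_mult order_rel_value_group)
  qed
qed

text \<open>The dictionary for all later estimates. It includes 0, which is a multiple of everything
  and divides only itself, in accordance with the value infinity.\<close>

lemma val_le_iff: "val_le value_group (val x) (val y) \<longleftrightarrow> (\<exists>c\<in>V. y = c * x)"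
proof (cases "x = 0 \<or> y = 0")
  case True
  then show ?thesis
    using zero_mem by (auto simp: val_def intro!: bexI[of _ 0])
next
  case False
  then show ?thesis
    by (auto simp: val_def order_rel_value_group intro!: bexI[of _ "y / x"])
qed

lemma val_eq_iff: "val x = val y \<longleftrightarrow> (\<exists>u\<in>units. y = u * x)"
proof (cases "x = 0 \<or> y = 0")
  case True
  then show ?thesis
    using one_units units_nonzero by (auto simp: val_def)
next
  case False
  then show ?thesis
    using unit_coset_eq_iff[of y x] by (auto simp: val_def intro!: bexI[of _ "y / x"])
qed

lemma valuation_val:
  assumes "unital_subfield F"
  shows "valuation (field_on F) value_group val"
proof -
  interpret linearly_ordered_comm_group value_group by (rule linearly_ordered_value_group)
  interpret field "field_on F" by (rule unital_subfield.field_field_on[OF assms])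
  show ?thesis
  proof
    fix x y
    show "val x \<in> insert None (Some ` carrier value_group)"
      by (simp add: val_def unit_coset_carrier)
    show "val x = None \<longleftrightarrow> x = \<zero>\<^bsub>field_on F\<^esub>"
      by (simp add: val_def)
    show "val (x \<otimes>\<^bsub>field_on F\<^esub> y) = val_add value_group (val x) (val y)"
      by (simp add: val_def unit_coset_mult)
    \<comment> \<open>Whichever quotient of \<open>x\<close> and \<open>y\<close> lies in
      \<open>V\<close>, the sum is a multiple of the denominator, the element of smaller
      value.\<close>
    have "x + y = (1 + y / x) * x" if "x \<noteq> 0" using that by (simp add: field_simps)
    moreover have "x + y = (1 + x / y) * y" if "y \<noteq> 0" using that by (simp add: field_simps)
    ultimately show "val_le value_group (val x) (val (x \<oplus>\<^bsub>field_on F\<^esub> y)) \<or>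
        val_le value_group (val y) (val (x \<oplus>\<^bsub>field_on F\<^esub> y))"
      using mem_or_inverse_mem[of "x / y"] add_mem[OF one_mem] one_mem
      by (cases "x = 0"; cases "y = 0") (auto simp: val_le_iff intro: exI[of _ 1], metis+)
  qed
qed

end

section \<open>Algebraic elements and algebraic closures\<close>

text \<open>Record-based polynomials list the leading coefficient first, type class polynomials the
  constant one; hence the reversal.\<close>

abbreviation poly_of_list :: "'a::zero list \<Rightarrow> 'a poly" where
  "poly_of_list p \<equiv> Poly (rev p)"

lemma poly_Poly_rev_Cons:
  "poly (poly_of_list (a # p)) x = a * x ^ length p + poly (poly_of_list p) (x :: 'a::comm_ring_1)"
  by (simp add: Poly_append poly_monom)

context unital_subring
begin

definition algebraic_elem :: "'a \<Rightarrow> bool" where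
  "algebraic_elem x \<longleftrightarrow> (\<exists>q\<in>polys. q \<noteq> 0 \<and> poly q x = 0)"

lemma mem_imp_algebraic_elem: "x \<in> R \<Longrightarrow> algebraic_elem x"
  unfolding algebraic_elem_def
  by (rule bexI[of _ "[:- x, 1:]"]) (auto simp: pCons_polys zero_polys one_mem uminus_mem)

end

context unital_subfield
begin

sublocale A: field "field_on F"
  by (rule field_field_on)

lemma nat_pow_field_on: "x [^]\<^bsub>field_on F\<^esub> (n::nat) = x ^ n"
  by (induction n) (simp_all add: mult.commute)

lemma eval_field_on: "A.eval p x = poly (poly_of_list p) x"
  by (induction p) (simp_all only: A.eval.simps poly_Poly_rev_Cons nat_pow_field_on, simp_all)

end

section \<open>Algebraicity, simple extensions and degrees in terms of type class
  polynomials\<close>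

locale subfield_extension = unital_subfield F + E: unital_subfield E for F E :: "'a::field set" +
  assumes E_subset_F: "E \<subseteq> F"
begin

lemma subfield_E: "subfield E (field_on F)"
  using E.unital_subfield_axioms E_subset_F by (rule subfield_field_on)

lemma poly_of_list_carrier:
  assumes "p \<in> carrier (E[X]\<^bsub>field_on F\<^esub>)"
  shows "poly_of_list p \<in> E.polys" "poly_of_list p = 0 \<longleftrightarrow> p = []"
    "Polynomial.degree (poly_of_list p) = length p - 1"
proof -
  have p: "p = [] \<or> set p \<subseteq> E \<and> hd p \<noteq> 0"
    using assms by (simp add: univ_poly_def polynomial_def)
  then show "poly_of_list p \<in> E.polys"
    by (auto simp: E.polys_def nth_default_def E.zero_mem rev_nth subset_iff)
  have "coeffs (poly_of_list p) = rev p"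
    using p by (cases p) (auto simp: strip_while_def)
  then show "poly_of_list p = 0 \<longleftrightarrow> p = []" "Polynomial.degree (poly_of_list p) = length p - 1"
    by (metis coeffs_eq_Nil rev_is_Nil_conv, metis degree_eq_length_coeffs length_rev)
qed

lemma list_of_poly_carrier:
  assumes "q \<in> E.polys"
  shows "rev (coeffs q) \<in> carrier (E[X]\<^bsub>field_on F\<^esub>)"
proof (cases "q = 0")
  case False
  then have "hd (rev (coeffs q)) \<noteq> 0"
    by (simp add: hd_rev last_coeffs_eq_coeff_degree)
  moreover have "set (rev (coeffs q)) \<subseteq> E"
    using assms by (auto simp: coeffs_def E.polys_def)
  ultimately show ?thesis
    by (simp add: univ_poly_def polynomial_def)
qed (simp add: univ_poly_def polynomial_def)

lemma algebraic_iff: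
  assumes "x \<in> F"
  shows "(A.algebraic over E) x \<longleftrightarrow> E.algebraic_elem x"
proof
  assume "(A.algebraic over E) x"
  then obtain p where "p \<in> carrier (E[X]\<^bsub>field_on F\<^esub>)" "p \<noteq> []" "A.eval p x = 0"
    using A.algebraicE[OF subfieldE(1)[OF subfield_E], of x] assms by auto
  then show "E.algebraic_elem x"
    using poly_of_list_carrier unfolding E.algebraic_elem_def eval_field_on by blast
next
  assume "E.algebraic_elem x"
  then obtain q where q: "q \<in> E.polys" "q \<noteq> 0" "poly q x = 0"
    by (auto simp: E.algebraic_elem_def)
  show "(A.algebraic over E) x"
    by (rule A.algebraicI[OF list_of_poly_carrier[OF q(1)]]) (use q in \<open>auto simp: eval_field_on\<close>)
qed

lemma simple_extension_eq:
  assumes "x \<in> F"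
  shows "A.simple_extension E x = E.adjunction x"
proof -
  have "A.simple_extension E x = (\<lambda>p. A.eval p x) ` carrier (E[X]\<^bsub>field_on F\<^esub>)"
    using A.simple_extension_as_eval_img[of E x] assms E_subset_F by simp
  also have "\<dots> = E.adjunction x"
  proof (intro equalityI subsetI)
    fix y assume "y \<in> (\<lambda>p. A.eval p x) ` carrier (E[X]\<^bsub>field_on F\<^esub>)"
    then show "y \<in> E.adjunction x"
      using poly_of_list_carrier(1) by (auto simp: eval_field_on intro: E.adjunctionI)
  next
    fix y assume "y \<in> E.adjunction x"
    then obtain q where "q \<in> E.polys" "y = poly q x"
      by (auto simp: E.adjunction_def)
    then show "y \<in> (\<lambda>p. A.eval p x) ` carrier (E[X]\<^bsub>field_on F\<^esub>)"
      using list_of_poly_carrier by (auto simp: eval_field_on image_iff intro!: bexI[of _ "rev (coeffs q)"])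
  qed
  finally show ?thesis .
qed

lemma subfield_adjunction:
  assumes "x \<in> F" "E.algebraic_elem x"
  shows "subfield (E.adjunction x) (field_on F)"
  using A.simple_extension_is_subfield[OF subfield_E] assms
  by (simp add: simple_extension_eq algebraic_iff)

text \<open>For algebraic \<open>x\<close> the ring of polynomial values is already a field, so it
  is the field generated by \<open>x\<close>.\<close>

lemma adjoin_eq:
  assumes "x \<in> F" "E.algebraic_elem x"
  shows "adjoin (field_on F) E x = E.adjunction x"
proof
  show "adjoin (field_on F) E x \<subseteq> E.adjunction x"
    using assms E_subset_F E.base_subset_adjunction E.gen_mem_adjunction
    by (intro A.generate_field_min_subfield1 subfield_adjunction) auto
  have gen: "subfield (adjoin (field_on F) E x) (field_on F)"
    "insert x E \<subseteq> adjoin (field_on F) E x"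
    using assms E_subset_F A.generate_field_is_subfield[of "insert x E"]
    by (auto intro: generate_field.incl)
  show "E.adjunction x \<subseteq> adjoin (field_on F) E x"
    using A.simple_extension_subring_incl[OF subfieldE(1)[OF gen(1)], of E x] gen(2) assms(1)
    by (simp add: simple_extension_eq)
qed

lemma finite_dimension_adjunction:
  assumes "x \<in> F" "E.algebraic_elem x"
  shows "A.finite_dimension E (E.adjunction x)"
  using A.finite_dimension_simple_extension[OF subfield_E, of x] assms
  by (simp add: simple_extension_eq algebraic_iff)

text \<open>The dimension equals the degree of the minimal polynomial. Here it is recast as the
  least degree of a nonzero annihilating polynomial, so later arguments never mention the minimal
  polynomial itself.\<close>

lemma degree_over_properties:
  assumes "x \<in> F" "E.algebraic_elem x"
  shows "\<exists>q\<in>E.polys. q \<noteq> 0 \<and> poly q x = 0 \<and>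
      Polynomial.degree q = degree_over (field_on F) E x" (is ?thesis1)
    and "q \<in> E.polys \<Longrightarrow> q \<noteq> 0 \<Longrightarrow> poly q x = 0 \<Longrightarrow>
      degree_over (field_on F) E x \<le> Polynomial.degree q" (is "PROP ?thesis2")
proof -
  have x: "x \<in> carrier (field_on F)" "(A.algebraic over E) x"
    using assms algebraic_iff by auto
  note Irr = A.IrrE[OF subfield_E x]
  have nonempty: "A.Irr E x \<noteq> []"
    using Irr(2) by (auto simp: ring_irreducible_def univ_poly_zero)
  have deg: "degree_over (field_on F) E x = length (A.Irr E x) - 1"
    using A.simple_extension_dim[OF subfield_E x] assms
    by (simp add: degree_over_def adjoin_eq simple_extension_eq over_def)
  show ?thesis1
    using poly_of_list_carrier[OF Irr(1)] nonempty Irr(4) deg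
    by (auto simp: eval_field_on intro!: bexI[of _ "poly_of_list (A.Irr E x)"])
  show "PROP ?thesis2"
  proof -
    assume q: "q \<in> E.polys" "q \<noteq> 0" "poly q x = 0"
    have "A.Irr E x pdivides\<^bsub>field_on F\<^esub> rev (coeffs q)"
      by (rule A.Irr_minimal[OF subfield_E x list_of_poly_carrier[OF q(1)]])
        (use q in \<open>simp add: eval_field_on\<close>)
    from A.pdivides_imp_degree_le[OF subfieldE(1)[OF subfield_E] Irr(1)
        list_of_poly_carrier[OF q(1)] _ this] q(2)
    show "degree_over (field_on F) E x \<le> Polynomial.degree q"
      by (simp add: deg degree_eq_length_coeffs)
  qed
qed

end
lemma unital_subfield_UNIV: "unital_subfield (UNIV :: 'a::field set)"
  by unfold_locales auto

section \<open>The algebraic elements of an algebraically closed field form an algebraic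
  closure\<close>

locale algebraic_elements = unital_subfield E for E :: "'a::alg_closed_field set"
begin

sublocale U: subfield_extension UNIV E
  by (intro subfield_extension.intro subfield_extension_axioms.intro unital_subfield_UNIV
      unital_subfield_axioms) simp

definition algebraics :: "'a set" where
  "algebraics = {x. algebraic_elem x}"

lemma unital_subfield_algebraics: "unital_subfield algebraics"
proof -
  have "{x \<in> carrier (field_on UNIV). (U.A.algebraic over E) x} = algebraics"
    by (simp add: algebraics_def U.algebraic_iff)
  then show ?thesis
    using U.A.subfield_of_algebraics[OF U.subfield_E]
      unital_subfield_of_subfield[OF unital_subfield_UNIV] by metis
qed

sublocale S: subfield_extension algebraics E
  by (intro subfield_extension.intro subfield_extension_axioms.intro unital_subfield_algebraics
      unital_subfield_axioms) (auto simp: algebraics_def mem_imp_algebraic_elem)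

text \<open>The coefficients generate a finite extension \<open>G\<close> of \<open>E\<close>, over
  which \<open>x\<close> is algebraic. By the tower law \<open>x\<close> lies in a finite extension
  of \<open>E\<close>.\<close>

lemma root_mem_algebraics:
  assumes p: "set p \<subseteq> algebraics" "poly_of_list p \<noteq> 0" "poly (poly_of_list p) x = 0"
  shows "x \<in> algebraics"
proof -
  define G where "G = U.A.finite_extension E p"
  have alg: "(U.A.algebraic over E) y" if "y \<in> set p" for y
    using that p(1) by (auto simp: algebraics_def U.algebraic_iff)
  have p_carrier: "set p \<subseteq> carrier (field_on UNIV)"
    by simp
  have G: "subfield G (field_on UNIV)" "U.A.finite_dimension E G" "set p \<subseteq> G"
    unfolding G_def using U.A.finite_extension_is_subfield[OF U.subfield_E p_carrier alg]
      U.A.finite_extension_finite_dimension(1)[OF U.subfield_E p_carrier alg]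
      U.A.finite_extension_mem[OF subfieldE(1)[OF U.subfield_E] p_carrier] by auto
  interpret G: unital_subfield G
    by (rule unital_subfield_of_subfield[OF unital_subfield_UNIV G(1)])
  interpret UG: subfield_extension UNIV G
    by unfold_locales simp
  have "poly_of_list p \<in> G.polys"
    using G(3) by (auto simp: G.polys_def nth_default_def G.zero_mem rev_nth subset_iff)
  then have x: "G.algebraic_elem x"
    using p by (auto simp: G.algebraic_elem_def)
  have "U.A.finite_dimension E (G.adjunction x)"
    using U.A.telescopic_base_dim(1)[OF U.subfield_E G(1,2)] UG.finite_dimension_adjunction[OF _ x]
    by simp
  moreover have "subring (G.adjunction x) (field_on UNIV)"
    using subfieldE(1)[OF UG.subfield_adjunction[OF _ x]] by simp
  ultimately have "(U.A.algebraic over E) x"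
    using U.A.finite_dimension_imp_algebraic[OF U.subfield_E] G.gen_mem_adjunction by blast
  then show ?thesis
    by (simp add: algebraics_def U.algebraic_iff)
qed

theorem algebraic_closure_algebraics: "algebraic_closure (field_on algebraics) E"
proof -
  interpret SS: subfield_extension algebraics algebraics
    by unfold_locales simp
  interpret algebraically_closed "field_on algebraics"
  proof (rule S.A.algebraically_closedI)
    fix p assume p: "p \<in> carrier (poly_ring (field_on algebraics))" "length p - 1 > 1"
    then have p': "p \<in> carrier (algebraics[X]\<^bsub>field_on algebraics\<^esub>)" by simp
    have "\<exists>x. poly (poly_of_list p) x = 0"
      using SS.poly_of_list_carrier(3)[OF p'] p(2) by (intro alg_closed_imp_poly_has_root) simp
    then obtain x where x: "poly (poly_of_list p) x = 0" ..
    moreover have "set p \<subseteq> algebraics" "poly_of_list p \<noteq> 0"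
      using p' p(2) SS.poly_of_list_carrier(2)[OF p'] by (auto simp: univ_poly_def polynomial_def)
    ultimately have "x \<in> algebraics" by (intro root_mem_algebraics)
    with x show "\<exists>x\<in>carrier (field_on algebraics). S.A.eval p x = \<zero>\<^bsub>field_on algebraics\<^esub>"
      by (auto simp: S.eval_field_on)
  qed
  show ?thesis
  proof (intro algebraic_closure.intro algebraic_closure_axioms.intro)
    show "field (field_on algebraics)" by (rule S.A.field_axioms)
    show "subfield E (field_on algebraics)" by (rule S.subfield_E)
    show "(S.A.algebraic over E) x" if "x \<in> carrier (field_on algebraics)" for x
      using that S.algebraic_iff[of x] unfolding algebraics_def by simp
    show "S.A.splitted P" if "P \<in> carrier (E[X]\<^bsub>field_on algebraics\<^esub>)" for P
      using roots_over_carrier S.A.carrier_polynomial_shell[OF subfieldE(1)[OF S.subfield_E] that]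
      by simp
  qed
qed

end

section \<open>The fourth root of 1 + i over the Gaussian rationals\<close>

definition gaussian_rationals :: "complex set" where
  "gaussian_rationals = {z. Re z \<in> \<rat> \<and> Im z \<in> \<rat>}"

lemma unital_subfield_gaussian_rationals: "unital_subfield gaussian_rationals"
  by unfold_locales (auto simp: gaussian_rationals_def)

lemma i_mem_gaussian_rationals: "\<i> \<in> gaussian_rationals"
  by (simp add: gaussian_rationals_def)

lemma gaussian_rational_fraction:
  assumes "z \<in> gaussian_rationals"
  obtains a b d :: int where "d \<noteq> 0" "z * of_int d = of_int a + of_int b * \<i>"
proof -
  obtain a b c d :: int where *: "b > 0" "d > 0"
    "Re z = of_int a / of_int b" "Im z = of_int c / of_int d"
    using assms unfolding gaussian_rationals_def by (auto elim!: Rats_cases')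
  then have "z * of_int (b * d) = of_int (a * d) + of_int (c * b) * \<i>"
    by (simp add: complex_eq_iff)
  then show thesis using * by (intro that[of "b * d" "a * d" "c * b"]) auto
qed

text \<open>The hypothesis \<open>half_notin\<close> says v(2) > 0. It is the only arithmetic
  information about \<open>V\<close>, and it determines all values on the Gaussian rationals up to
  scaling.\<close>

locale quartic_radical = valuation_ring V for V :: "complex set" +
  fixes \<theta> :: complex
  assumes half_notin: "inverse 2 \<notin> V" and theta_power: "\<theta> ^ 4 = 1 + \<i>"
begin

sublocale K: algebraic_elements gaussian_rationals
  by (intro algebraic_elements.intro unital_subfield_gaussian_rationals)

abbreviation \<pi> :: complex where "\<pi> \<equiv> 1 + \<i>"

lemma theta_nonzero: "\<theta> \<noteq> 0"
  using theta_power by (auto simp: complex_eq_iff)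

lemma pi_nonzero: "\<pi> \<noteq> 0"
  by (simp add: complex_eq_iff)

lemma two_nonunit: "2 \<notin> units"
  using half_notin by (simp add: units_def)

lemma i_units: "\<i> \<in> units"
proof -
  have "\<i> \<in> V" using mem_or_inverse_mem[of \<i>] uminus_mem[of "- \<i>"] by auto
  then show ?thesis by (simp add: units_def uminus_mem)
qed

lemma pi_mem: "\<pi> \<in> V"
  by (intro add_mem one_mem units_mem i_units)

lemma pi_square: "\<pi> ^ 2 = 2 * \<i>"
  by (simp add: power2_eq_square algebra_simps)

lemma pi_nonunit: "\<pi> \<notin> units"
proof
  assume "\<pi> \<in> units"
  then have "2 * \<i> \<in> units" using power_units pi_square by metis
  then show False
    using mult_units_cancel[of 2 \<i>] two_nonunit of_nat_mem[of 2] units_mem[OF i_units] by simp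
qed

lemma odd_units:
  assumes "odd k"
  shows "of_int k \<in> units"
proof -
  obtain m where k: "k = 2 * m + 1" using assms by (auto elim: oddE)
  have "2 * of_int m \<notin> units"
    using mult_units_cancel[of 2 "of_int m"] two_nonunit of_nat_mem[of 2] of_int_mem by auto
  then show ?thesis
    using units_add_nonunit[of 1 "2 * of_int m"] of_int_mem[of "2 * m"] k
    by (simp add: one_units add.commute)
qed

text \<open>Descent on the norm. If the norm is odd, it is a unit and the number divides it; if it
  is even, division by 1 + i stays among the Gaussian integers and halves the norm.\<close>

lemma gaussian_integer_valuation:
  fixes a b :: int
  assumes "a \<noteq> 0 \<or> b \<noteq> 0"
  shows "\<exists>n. \<exists>u\<in>units. of_int a + of_int b * \<i> = \<pi> ^ n * u"
  using assms
proof (induction "nat (a\<^sup>2 + b\<^sup>2)" arbitrary: a b rule: less_induct)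
  case less
  let ?z = "of_int a + of_int b * \<i> :: complex"
  show ?case
  proof (cases "even (a + b)")
    case False
    have "?z * (of_int a + of_int (- b) * \<i>) = of_int (a\<^sup>2 + b\<^sup>2)"
      by (simp add: power2_eq_square algebra_simps)
    also have "\<dots> \<in> units" using False by (intro odd_units) simp
    finally have "?z \<in> units"
      using units_mem[OF i_units]
      by (elim mult_units_cancel[rotated 2]) (intro add_mem mult_mem of_int_mem; simp)+
    then show ?thesis by (intro exI[of _ 0]) simp
  next
    case True
    then have "even (b - a)" by simp
    \<comment> \<open>The coordinates of (a + bi)/(1 + i) = ((a + b) + (b - a) i)/2.\<close>
    then obtain c d where cd: "a + b = 2 * c" "b - a = 2 * d"
      using True by (metis dvdE)
    then have ab: "a = c - d" "b = c + d" by simp_all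
    have "a\<^sup>2 + b\<^sup>2 = 2 * (c\<^sup>2 + d\<^sup>2)"
      by (simp add: ab power2_eq_square algebra_simps)
    moreover have "c\<^sup>2 + d\<^sup>2 > 0"
      using less.prems ab by (auto simp: sum_power2_gt_zero_iff)
    ultimately have "nat (c\<^sup>2 + d\<^sup>2) < nat (a\<^sup>2 + b\<^sup>2)" by simp
    from less.hyps[OF this] obtain n u
      where "u \<in> units" "of_int c + of_int d * \<i> = \<pi> ^ n * u"
      using less.prems ab by auto
    moreover have "?z = \<pi> * (of_int c + of_int d * \<i>)"
      by (simp add: ab algebra_simps)
    ultimately have "?z = \<pi> ^ Suc n * u" by simp
    with \<open>u \<in> units\<close> show ?thesis by blast
  qed
qed

lemma gaussian_rational_valuation:
  assumes "z \<in> gaussian_rationals" "z \<noteq> 0"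
  obtains m n u where "u \<in> units" "z = \<pi> ^ m * u / \<pi> ^ n"
proof -
  obtain a b d :: int where d: "d \<noteq> 0" and z: "z * of_int d = of_int a + of_int b * \<i>"
    using gaussian_rational_fraction assms(1) by blast
  have "a \<noteq> 0 \<or> b \<noteq> 0" using z d assms(2) by auto
  then obtain m u where u: "u \<in> units" "z * of_int d = \<pi> ^ m * u"
    using gaussian_integer_valuation z by metis
  obtain n w where w: "w \<in> units" "of_int d = \<pi> ^ n * w"
    using gaussian_integer_valuation[of d 0] d by auto
  have "z = z * of_int d / of_int d" using d by simp
  also have "\<dots> = \<pi> ^ m * (u / w) / \<pi> ^ n"
    unfolding u(2) unfolding w(2) by simp
  finally show thesis using that divide_units u(1) w(1) by blast
qed

lemma pi_power_quotient_unit: "\<pi> ^ a / \<pi> ^ b \<in> units \<Longrightarrow> a = b"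
proof (induction a b rule: linorder_wlog)
  case (le a b)
  have *: "n = 0" if "\<pi> ^ n \<in> units" for n
    using that mult_units_cancel[of \<pi> "\<pi> ^ (n - 1)"] pi_nonunit pi_mem power_mem[of \<pi>]
    by (cases n) auto
  have "inverse (\<pi> ^ a / \<pi> ^ b) = \<pi> ^ (b - a)"
    using le pi_nonzero by (simp add: power_diff)
  then show ?case using *[of "b - a"] inverse_units[OF le(2)] le(1) by simp
next
  case (sym a b)
  then show ?case using inverse_units[of "\<pi> ^ b / \<pi> ^ a"] inverse_units by fastforce
qed

text \<open>The hypothesis on \<open>t\<close> says 4 v(t) = v(\<open>\<pi>\<close>). The fourth
  power of the quotient is therefore a unit times an integral power of \<open>\<pi>\<close> whose
  exponent is congruent to i - j modulo 4, hence not 0. A general \<open>t\<close> is allowed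
  because elements close to \<open>\<theta>\<close> are treated too.\<close>

lemma distinct_values:
  assumes t: "t ^ 4 / \<pi> \<in> units"
    and kl: "k \<in> gaussian_rationals" "l \<in> gaussian_rationals" "k \<noteq> 0" "l \<noteq> 0"
    and ij: "i < 4" "j < 4" "i \<noteq> j"
  shows "(k * t ^ i) / (l * t ^ j) \<notin> units"
proof
  assume *: "(k * t ^ i) / (l * t ^ j) \<in> units"
  define w where "w = t ^ 4 / \<pi>"
  have w: "w \<in> units" "t ^ 4 = \<pi> * w"
    using t pi_nonzero by (simp_all add: w_def)
  obtain m n u where u: "u \<in> units" "k / l = \<pi> ^ m * u / \<pi> ^ n"
    using gaussian_rational_valuation[OF K.divide_mem[OF kl(1,2)]] kl(3,4) by (metis divide_eq_0_iff)
  define c where "c = u ^ 4 * w ^ i / w ^ j"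
  have c: "c \<in> units"
    unfolding c_def by (intro divide_units mult_units power_units u w)
  have "((k * t ^ i) / (l * t ^ j)) ^ 4 = (k / l) ^ 4 * (t ^ 4) ^ i / (t ^ 4) ^ j"
    by (simp add: power_mult_distrib power_divide power_mult[symmetric] mult.commute)
  also have "\<dots> = \<pi> ^ (4 * m + i) / \<pi> ^ (4 * n + j) * c"
    unfolding u(2) w(2) c_def
    by (simp add: power_mult_distrib power_divide power_mult[symmetric] power_add mult_ac)
  finally have "\<pi> ^ (4 * m + i) / \<pi> ^ (4 * n + j) = ((k * t ^ i) / (l * t ^ j)) ^ 4 / c"
    using units_nonzero[OF c] by simp
  also have "\<dots> \<in> units" by (intro divide_units power_units * c)
  finally have "4 * m + i = 4 * n + j" by (rule pi_power_quotient_unit)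
  then show False using ij by presburger
qed

text \<open>The central estimate: the value at \<open>t\<close> is the least value of a term. Its
  vanishing case gives independence of the powers of \<open>t\<close>, its divisibility gives the
  bound on \<open>\<tau>\<close>.\<close>

lemma term_divisible_by_poly:
  assumes "p \<in> K.polys" "Polynomial.degree p < 4" "t ^ 4 / \<pi> \<in> units"
  shows "\<exists>c\<in>V. poly.coeff p i * t ^ i = c * poly p t"
proof (cases "i < 4")
  case True
  have "poly p t = (\<Sum>i<4. poly.coeff p i * t ^ i)"
    unfolding poly_altdef using assms(2)
    by (intro sum.mono_neutral_left) (auto simp: not_le coeff_eq_0)
  moreover have "\<exists>c\<in>V. poly.coeff p i * t ^ i = c * (\<Sum>i<4. poly.coeff p i * t ^ i)"
    using True assms by (intro term_mem_multiples_of_sum distinct_values) (auto simp: K.coeff_polys)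
  ultimately show ?thesis by simp
next
  case False
  then show ?thesis
    using assms(2) zero_mem by (intro bexI[of _ 0]) (auto simp: coeff_eq_0)
qed

lemma poly_eq_0_imp:
  assumes "p \<in> K.polys" "Polynomial.degree p < 4" "t ^ 4 / \<pi> \<in> units" "poly p t = 0"
  shows "p = 0"
proof (rule poly_eqI)
  fix i
  have "t \<noteq> 0" using units_nonzero[OF assms(3)] by auto
  then show "poly.coeff p i = poly.coeff 0 i"
    using term_divisible_by_poly[OF assms(1-3), of i] assms(4) by auto
qed

end

section \<open>The Galois group\<close>

lemma mem_Gal_field_on:
  "\<sigma> \<in> carrier (Gal (field_on F) K L) \<longleftrightarrow> \<sigma> \<in> Bij L \<and> (\<forall>x\<in>K. \<sigma> x = x) \<and> \<sigma> 1 = 1 \<and>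
     (\<forall>x\<in>L. \<forall>y\<in>L. \<sigma> (x * y) = \<sigma> x * \<sigma> y \<and> \<sigma> (x + y) = \<sigma> x + \<sigma> y)"
  using Bij_imp_funcset[of \<sigma> L] by (auto simp: Gal_def ring_hom_def)

lemma group_Gal_field_on:
  assumes "unital_subfield L" "K \<subseteq> L"
  shows "group (Gal (field_on F) K L)"
proof -
  interpret L: unital_subfield L by fact
  interpret group "BijGroup L" by (rule group_BijGroup)
  let ?H = "carrier (Gal (field_on F) K L)"
  have "subgroup ?H (BijGroup L)"
  proof (rule subgroupI)
    show "?H \<subseteq> carrier (BijGroup L)"
      by (auto simp: mem_Gal_field_on BijGroup_def)
    have "(\<lambda>x\<in>L. x) \<in> ?H"
      using assms(2) L.one_mem
      by (auto simp: mem_Gal_field_on id_Bij L.mult_mem L.add_mem)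
    then show "?H \<noteq> {}" by blast
  next
    fix \<sigma> assume \<sigma>: "\<sigma> \<in> ?H"
    then have bij: "\<sigma> \<in> Bij L" and hom: "\<And>x y. x \<in> L \<Longrightarrow> y \<in> L \<Longrightarrow> \<sigma> (x * y) = \<sigma> x * \<sigma> y"
      "\<And>x y. x \<in> L \<Longrightarrow> y \<in> L \<Longrightarrow> \<sigma> (x + y) = \<sigma> x + \<sigma> y" "\<sigma> 1 = 1" "\<And>x. x \<in> K \<Longrightarrow> \<sigma> x = x"
      by (auto simp: mem_Gal_field_on)
    define \<tau> where "\<tau> = (\<lambda>x\<in>L. inv_into L \<sigma> x)"
    have \<tau>: "inv\<^bsub>BijGroup L\<^esub> \<sigma> = \<tau>" "\<tau> \<in> Bij L"
      unfolding \<tau>_def using bij by (simp_all add: inv_BijGroup restrict_inv_into_Bij)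
    have "bij_betw \<sigma> L L" using bij by (simp add: Bij_def)
    then have cancel: "\<tau> (\<sigma> x) = x" "\<sigma> x \<in> L" "\<sigma> (\<tau> x) = x" "\<tau> x \<in> L" if "x \<in> L" for x
      using that unfolding \<tau>_def
      by (simp_all add: bij_betwE bij_betw_inv_into_left bij_betw_inv_into_right
          bij_betw_apply[OF bij_betw_inv_into])
    have "\<tau> (x * y) = \<tau> x * \<tau> y" "\<tau> (x + y) = \<tau> x + \<tau> y" if "x \<in> L" "y \<in> L" for x y
      using hom(1,2)[of "\<tau> x" "\<tau> y"] cancel that L.mult_mem L.add_mem by metis+
    moreover have "\<tau> 1 = 1" "\<And>x. x \<in> K \<Longrightarrow> \<tau> x = x"
      using cancel(1) hom(3,4) L.one_mem assms(2) by (metis, metis subsetD)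
    ultimately show "inv\<^bsub>BijGroup L\<^esub> \<sigma> \<in> ?H"
      using \<tau> by (simp add: mem_Gal_field_on)
  next
    fix \<sigma> \<tau> assume *: "\<sigma> \<in> ?H" "\<tau> \<in> ?H"
    then have bij: "\<sigma> \<in> Bij L" "\<tau> \<in> Bij L" by (auto simp: mem_Gal_field_on)
    have "\<tau> x \<in> L" if "x \<in> L" for x
      using Bij_imp_funcset[OF bij(2)] that by auto
    then show "\<sigma> \<otimes>\<^bsub>BijGroup L\<^esub> \<tau> \<in> ?H"
      using * bij L.one_mem L.mult_mem L.add_mem assms(2)
      by (auto simp: mem_Gal_field_on BijGroup_def compose_Bij compose_eq subset_iff)
  qed
  from subgroup.subgroup_is_group[OF this is_group] show ?thesis
    by (simp add: Gal_def)
qed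

context quartic_radical
begin

abbreviation F :: "complex set" where "F \<equiv> gaussian_rationals"

definition L :: "complex set" where
  "L = K.adjunction \<theta>"

lemma pi_mem_F: "\<pi> \<in> F"
  by (simp add: gaussian_rationals_def)

definition radical_poly :: "complex poly" where
  "radical_poly = [:- \<pi>, 0, 0, 0, 1:]"

lemma radical_poly: "radical_poly \<in> K.polys" "radical_poly \<noteq> 0"
    "Polynomial.degree radical_poly = 4" "poly radical_poly t = 0 \<longleftrightarrow> t ^ 4 = \<pi>"
  using K.uminus_mem[OF pi_mem_F]
  by (auto simp: radical_poly_def K.pCons_polys K.zero_polys K.zero_mem K.one_mem
      eval_nat_numeral algebra_simps)

lemma finite_conjugates: "finite {t. t ^ 4 = \<pi>}"
  using poly_roots_finite[OF radical_poly(2)] by (simp add: radical_poly(4))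

lemma theta_algebraic: "K.algebraic_elem \<theta>" and theta_mem: "\<theta> \<in> K.algebraics"
  using radical_poly theta_power unfolding K.algebraics_def K.algebraic_elem_def by auto

lemma L_subfield: "subfield L (field_on K.algebraics)"
  unfolding L_def by (rule K.S.subfield_adjunction[OF theta_mem theta_algebraic])

sublocale L: unital_subfield L
  using unital_subfield_of_subfield[OF K.unital_subfield_algebraics L_subfield] .

lemma F_subset_L: "F \<subseteq> L" and theta_mem_L: "\<theta> \<in> L"
  unfolding L_def by (rule K.base_subset_adjunction, rule K.gen_mem_adjunction)

lemma L_subset_algebraics: "L \<subseteq> K.algebraics"
  using subfieldE(3)[OF L_subfield] by simp

lemma poly_mem_L: "q \<in> K.polys \<Longrightarrow> poly q \<theta> \<in> L"
  by (auto simp: L_def intro: K.adjunctionI)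

lemma LE: "x \<in> L \<Longrightarrow> (\<And>q. q \<in> K.polys \<Longrightarrow> x = poly q \<theta> \<Longrightarrow> thesis) \<Longrightarrow> thesis"
  by (auto simp: L_def K.adjunction_def)

text \<open>Division by X^4 - \<open>\<pi>\<close>. One remainder works at all four roots
  simultaneously, so reduction is compatible with passing to conjugates.\<close>

lemma reduce_degree:
  assumes "q \<in> K.polys"
  obtains r where "r \<in> K.polys" "Polynomial.degree r < 4" "\<And>t. t ^ 4 = \<pi> \<Longrightarrow> poly q t = poly r t"
proof -
  have "\<exists>a b c d. [:a, b, c, d:] \<in> K.polys \<and> (\<forall>t. t ^ 4 = \<pi> \<longrightarrow> poly q t = poly [:a, b, c, d:] t)"
    using assms
  proof (induction q)
    case 0
    then show ?case by (intro exI[of _ 0]) (simp add: K.zero_polys)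
  next
    case (pCons e q)
    then obtain a b c d where *: "[:a, b, c, d:] \<in> K.polys"
      "\<forall>t. t ^ 4 = \<pi> \<longrightarrow> poly q t = poly [:a, b, c, d:] t"
      by (auto simp: K.pCons_polys)
    \<comment> \<open>Multiplication by X shifts the coefficients, and d X^4 returns as the constant
      \<open>\<pi> * d\<close>.\<close>
    have "[:e + \<pi> * d, a, b, c:] \<in> K.polys"
      using * pCons.prems pi_mem_F
      by (simp add: K.pCons_polys K.zero_polys K.add_mem K.mult_mem)
    moreover have "poly (pCons e q) t = poly [:e + \<pi> * d, a, b, c:] t" if "t ^ 4 = \<pi>" for t
    proof -
      have "poly (pCons e q) t = e + t ^ 4 * d + t * (a + t * (b + t * c))"
        using *(2) that by (simp add: eval_nat_numeral algebra_simps)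
      then show ?thesis unfolding that by simp
    qed
    ultimately show ?case by blast
  qed
  then obtain a b c d where *: "[:a, b, c, d:] \<in> K.polys"
    "\<And>t. t ^ 4 = \<pi> \<Longrightarrow> poly q t = poly [:a, b, c, d:] t"
    by blast
  have "Polynomial.degree [:a, b, c, d:] < 4"
    by (simp add: degree_pCons_eq_if)
  with * that show thesis by blast
qed

lemma conjugate_unit: "t ^ 4 = \<pi> \<Longrightarrow> t ^ 4 / \<pi> \<in> units"
  using pi_nonzero one_units by simp

text \<open>The reduction of \<open>p - q\<close> has degree below 4 and vanishes at
  \<open>s\<close>, so it is 0, and \<open>p - q\<close> vanishes at every root. This makes sending
  one root to another well defined.\<close>

lemma poly_conjugate_eq:
  assumes "p \<in> K.polys" "q \<in> K.polys" "s ^ 4 = \<pi>" "t ^ 4 = \<pi>" "poly p s = poly q s"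
  shows "poly p t = poly q t"
proof -
  obtain r where r: "r \<in> K.polys" "Polynomial.degree r < 4"
    "\<And>t. t ^ 4 = \<pi> \<Longrightarrow> poly (p - q) t = poly r t"
    using reduce_degree[OF K.diff_polys[OF assms(1,2)]] by metis
  have "r = 0"
    by (rule poly_eq_0_imp[OF r(1,2) conjugate_unit[OF assms(3)]])
      (use r(3)[OF assms(3)] assms(5) in simp)
  then show ?thesis using r(3)[OF assms(4)] by simp
qed

text \<open>For a fourth root of unity \<open>\<omega>\<close> this is the automorphism
  \<open>\<theta>\<close> -> \<open>\<omega> * \<theta>\<close>; the choice of the representing
  polynomial is immaterial by \<open>poly_conjugate_eq\<close>. Restriction to \<open>L\<close>
  gives the extensionality expected of Galois group elements.\<close>

definition rotation :: "complex \<Rightarrow> complex \<Rightarrow> complex" where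
  "rotation \<omega> = (\<lambda>x\<in>L. poly (SOME q. q \<in> K.polys \<and> poly q \<theta> = x) (\<omega> * \<theta>))"

lemma rotation_power: "\<omega> ^ 4 = 1 \<Longrightarrow> (\<omega> * \<theta>) ^ 4 = \<pi>"
  by (simp add: power_mult_distrib theta_power)

lemma rotation_poly:
  assumes "q \<in> K.polys" "\<omega> ^ 4 = 1"
  shows "rotation \<omega> (poly q \<theta>) = poly q (\<omega> * \<theta>)"
proof -
  let ?p = "SOME p. p \<in> K.polys \<and> poly p \<theta> = poly q \<theta>"
  have "?p \<in> K.polys \<and> poly ?p \<theta> = poly q \<theta>"
    by (rule someI[of _ q]) (simp add: assms)
  then have "poly ?p (\<omega> * \<theta>) = poly q (\<omega> * \<theta>)"
    using poly_conjugate_eq[OF _ assms(1) theta_power rotation_power[OF assms(2)]] by blast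
  then show ?thesis
    by (simp add: rotation_def poly_mem_L[OF assms(1)])
qed

lemma rotation_theta: "\<omega> ^ 4 = 1 \<Longrightarrow> rotation \<omega> \<theta> = \<omega> * \<theta>"
  using rotation_poly[of "[:0, 1:]" \<omega>]
  by (simp add: K.pCons_polys K.zero_polys K.zero_mem K.one_mem)

text \<open>Because \<open>\<omega>\<close> lies in \<open>F\<close>, the polynomial
  q(\<open>\<omega>\<close> X) again has coefficients in \<open>F\<close>, and the next rotation can
  be applied to it.\<close>

lemma rotation_rotation:
  assumes "\<omega> \<in> F" "\<omega> ^ 4 = 1" "\<eta> ^ 4 = 1" "x \<in> L"
  shows "rotation \<omega> x \<in> L" "rotation \<eta> (rotation \<omega> x) = rotation (\<omega> * \<eta>) x"
proof -
  from \<open>x \<in> L\<close> obtain q where q: "q \<in> K.polys" "x = poly q \<theta>" by (rule LE)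
  have *: "poly q (\<omega> * t) = poly (q \<circ>\<^sub>p [:0, \<omega>:]) t" for t
    by (simp add: poly_pcompose mult.commute)
  have q': "q \<circ>\<^sub>p [:0, \<omega>:] \<in> K.polys" by (rule K.scale_polys[OF q(1) assms(1)])
  have eq: "rotation \<omega> x = poly (q \<circ>\<^sub>p [:0, \<omega>:]) \<theta>"
    using q assms by (simp only: rotation_poly *)
  then show "rotation \<omega> x \<in> L" using poly_mem_L[OF q'] by simp
  show "rotation \<eta> (rotation \<omega> x) = rotation (\<omega> * \<eta>) x"
    using q assms rotation_poly[OF q', of \<eta>]
    by (simp add: eq rotation_poly power_mult_distrib *[symmetric] mult.assoc)
qed

lemma rotation_one: "x \<in> L \<Longrightarrow> rotation 1 x = x"
  by (erule LE) (simp add: rotation_poly)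

abbreviation G :: "(complex \<Rightarrow> complex) monoid" where
  "G \<equiv> Gal (field_on K.algebraics) F L"

sublocale G: group G
  by (rule group_Gal_field_on[OF L.unital_subfield_axioms F_subset_L])

lemma rotation_mem_Gal:
  assumes "\<omega> \<in> F" "\<omega> ^ 4 = 1"
  shows "rotation \<omega> \<in> carrier G"
proof -
  have inverse: "inverse \<omega> \<in> F" "inverse \<omega> ^ 4 = 1" "\<omega> \<noteq> 0"
    using assms K.inverse_mem by (auto simp: power_inverse)
  have "bij_betw (rotation \<omega>) L L"
    using assms inverse rotation_rotation rotation_one
    by (intro bij_betwI[where g = "rotation (inverse \<omega>)"]) auto
  moreover have "rotation \<omega> x = x" if "x \<in> F" for x
    using rotation_poly[of "[:x:]" \<omega>] assms that by (simp add: K.const_polys)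
  moreover have "rotation \<omega> (x * y) = rotation \<omega> x * rotation \<omega> y"
    "rotation \<omega> (x + y) = rotation \<omega> x + rotation \<omega> y" if xy: "x \<in> L" "y \<in> L" for x y
  proof -
    obtain p q where "p \<in> K.polys" "q \<in> K.polys" "x = poly p \<theta>" "y = poly q \<theta>"
      using xy by (metis LE)
    then show "rotation \<omega> (x * y) = rotation \<omega> x * rotation \<omega> y"
      "rotation \<omega> (x + y) = rotation \<omega> x + rotation \<omega> y"
      using assms rotation_poly[OF K.mult_polys, of p q] rotation_poly[OF K.add_polys, of p q]
      by (simp_all add: rotation_poly)
  qed
  ultimately show ?thesis
    using K.one_mem by (simp add: mem_Gal_field_on Bij_def rotation_def)
qed

lemma Gal_poly:
  assumes "\<sigma> \<in> carrier G" "q \<in> K.polys"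
  shows "\<sigma> (poly q \<theta>) = poly q (\<sigma> \<theta>)"
  using assms(2)
proof (induction q)
  case 0
  then show ?case using assms(1) K.zero_mem by (simp add: mem_Gal_field_on)
next
  case (pCons a q)
  then show ?case
    using assms(1) F_subset_L poly_mem_L theta_mem_L L.mult_mem
    by (auto simp: mem_Gal_field_on K.pCons_polys subset_iff)
qed

text \<open>An automorphism is determined by the root to which it sends \<open>\<theta>\<close>.
  Finiteness is what later gives \<open>card\<close> of the ramification ideals its meaning.\<close>

lemma finite_Gal: "finite (carrier G)"
proof (rule finite_imageD)
  have "(\<sigma> \<theta>) ^ 4 = \<pi>" if "\<sigma> \<in> carrier G" for \<sigma>
    using Gal_poly[OF that radical_poly(1)] radical_poly(4)[of \<theta>] radical_poly(4)[of "\<sigma> \<theta>"]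
      theta_power that K.zero_mem by (simp add: mem_Gal_field_on)
  then show "finite ((\<lambda>\<sigma>. \<sigma> \<theta>) ` carrier G)"
    by (auto intro: finite_subset[OF _ finite_conjugates])
  show "inj_on (\<lambda>\<sigma>. \<sigma> \<theta>) (carrier G)"
  proof (rule inj_onI)
    fix \<sigma> \<tau> assume *: "\<sigma> \<in> carrier G" "\<tau> \<in> carrier G" "\<sigma> \<theta> = \<tau> \<theta>"
    show "\<sigma> = \<tau>"
    proof (rule extensionalityI)
      show "\<sigma> \<in> extensional L" "\<tau> \<in> extensional L"
        using * by (auto simp: mem_Gal_field_on Bij_def)
      show "\<sigma> x = \<tau> x" if "x \<in> L" for x
        using that * Gal_poly by (metis LE)
    qed
  qed
qed

lemma i_power_4: "\<i> ^ 4 = 1"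
  by (simp add: eval_nat_numeral)

text \<open>Invariance under \<open>\<theta>\<close> -> i \<open>\<theta>\<close> alone suffices:
  comparing coefficients in degrees below 4 gives a_j (i^j - 1) = 0, and i^j differs from 1 for j =
  1, 2, 3.\<close>

lemma fixed_field: "{x \<in> L. \<forall>\<sigma>\<in>carrier G. \<sigma> x = x} = F"
proof (intro equalityI subsetI)
  fix x assume "x \<in> F"
  then show "x \<in> {x \<in> L. \<forall>\<sigma>\<in>carrier G. \<sigma> x = x}"
    using F_subset_L by (auto simp: mem_Gal_field_on)
next
  fix x assume x: "x \<in> {x \<in> L. \<forall>\<sigma>\<in>carrier G. \<sigma> x = x}"
  then obtain q where "q \<in> K.polys" "x = poly q \<theta>" by (auto elim: LE)
  then obtain r where r: "r \<in> K.polys" "Polynomial.degree r < 4" "x = poly r \<theta>"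
    using reduce_degree theta_power by metis
  define s where "s = r \<circ>\<^sub>p [:0, \<i>:] - r"
  have "poly r (\<i> * \<theta>) = poly r \<theta>"
    using x rotation_mem_Gal[OF i_mem_gaussian_rationals i_power_4]
      rotation_poly[OF r(1) i_power_4] r(3) by auto
  then have "poly s \<theta> = 0" by (simp add: s_def poly_pcompose mult.commute)
  moreover have "s \<in> K.polys"
    unfolding s_def by (intro K.diff_polys K.scale_polys r i_mem_gaussian_rationals)
  moreover have "Polynomial.degree s < 4"
    unfolding s_def using r(2) by (intro degree_diff_less) (simp_all add: degree_pcompose)
  ultimately have "s = 0"
    using poly_eq_0_imp conjugate_unit[OF theta_power] by blast
  then have coeff_s: "poly.coeff s j = 0" for j by simp
  have "poly.coeff r j = 0" if j: "j > 0" for j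
  proof (cases "j < 4")
    case True
    then consider "j = 1" | "j = 2" | "j = 3" using j by linarith
    then show ?thesis
      using coeff_s[of j] by cases (auto simp: s_def coeff_pcompose_linear eval_nat_numeral complex_eq_iff)
  next
    case False
    then show ?thesis using r(2) by (intro coeff_eq_0) simp
  qed
  then have "r = [:poly.coeff r 0:]"
    by (intro poly_eqI) (auto simp: coeff_pCons split: nat.splits)
  then have "x = poly.coeff r 0" using r(3) by (metis poly_const_conv)
  then show "x \<in> F" using K.coeff_polys[OF r(1)] by simp
qed

lemma finite_galois_valued_extension_L:
  "finite_galois_valued_extension (field_on K.algebraics) F L value_group val"
proof (intro finite_galois_valued_extension.intro finite_galois_valued_extension_axioms.intro)
  show "K.S.A.finite_dimension F L"
    unfolding L_def by (rule K.S.finite_dimension_adjunction[OF theta_mem theta_algebraic])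
qed (use K.algebraic_closure_algebraics valuation_val[OF K.unital_subfield_algebraics]
      L_subfield F_subset_L fixed_field in auto)

end

section \<open>Depth and ramification ideals\<close>

context quartic_radical
begin

abbreviation A :: "complex ring" where "A \<equiv> field_on K.algebraics"

lemma degree_over_rational: "b \<in> F \<Longrightarrow> degree_over A F b = 1"
proof -
  assume b: "b \<in> F"
  then have b': "b \<in> K.algebraics" "K.algebraic_elem b"
    using K.S.E_subset_F by (auto simp: K.mem_imp_algebraic_elem)
  obtain q where q: "q \<noteq> 0" "poly q b = 0" "Polynomial.degree q = degree_over A F b"
    using K.S.degree_over_properties(1)[OF b'] by blast
  have "Polynomial.degree q \<noteq> 0"
    using q(1,2) by (metis degree_eq_zeroE poly_const_conv pCons_0_0)
  moreover have "degree_over A F b \<le> Polynomial.degree [:- b, 1:]"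
    using b by (intro K.S.degree_over_properties(2)[OF b'])
      (auto simp: K.pCons_polys K.zero_polys K.one_mem K.uminus_mem)
  ultimately show ?thesis using q(3) by simp
qed

lemma degree_over_ge_4:
  assumes "t \<in> K.algebraics" "t ^ 4 / \<pi> \<in> units"
  shows "degree_over A F t \<ge> 4"
proof (rule ccontr)
  assume *: "\<not> degree_over A F t \<ge> 4"
  obtain q where "q \<in> K.polys" "q \<noteq> 0" "poly q t = 0" "Polynomial.degree q = degree_over A F t"
    using K.S.degree_over_properties(1)[OF assms(1)] assms(1) by (auto simp: K.algebraics_def)
  then show False
    using poly_eq_0_imp[OF _ _ assms(2), of q] * by simp
qed

lemma degree_over_theta: "degree_over A F \<theta> = 4"
  using degree_over_ge_4[OF theta_mem conjugate_unit[OF theta_power]]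
    K.S.degree_over_properties(2)[OF theta_mem theta_algebraic radical_poly(1,2)]
    radical_poly(3) radical_poly(4)[of \<theta>] theta_power by simp

lemma distances_theta:
  "distances A F val \<theta> m = {val (\<theta> - b) | b. b \<in> K.algebraics \<and> degree_over A F b = m}"
  unfolding distances_def by (auto simp: K.S.a_minus_field_on theta_mem) (metis K.S.a_minus_field_on theta_mem)+

text \<open>An element closer to \<open>\<theta>\<close> than \<open>0\<close> has the value of \<open>\<theta>\<close>, so its powers up to
  the third are independent over \<open>F\<close>.\<close>

lemma closer_to_theta:
  assumes "b \<in> K.algebraics" "val_less value_group (val \<theta>) (val (\<theta> - b))"
  shows "degree_over A F b \<ge> 4"
proof -
  obtain c where c: "c \<in> V" "\<theta> - b = c * \<theta>" "c \<notin> units"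
    using assms(2) by (auto simp: val_less_def val_le_iff val_eq_iff)
  have "b = (1 - c) * \<theta>" using c(2) by (simp add: algebra_simps)
  then have "b ^ 4 / \<pi> = (1 - c) ^ 4"
    using pi_nonzero by (simp add: power_mult_distrib theta_power)
  moreover have "- 1 \<in> units"
    by (simp add: units_def uminus_mem one_mem)
  then have "- c \<notin> units"
    using c(3) mult_units[of "- c" "- 1"] by auto
  then have "1 - c \<in> units"
    using units_add_nonunit[OF one_units, of "- c"] c(1) by (simp add: uminus_mem)
  ultimately have "b ^ 4 / \<pi> \<in> units" by (simp add: power_units)
  then show ?thesis by (rule degree_over_ge_4[OF assms(1)])
qed

text \<open>Degree 4 qualifies through \<open>\<theta>\<close> itself, at distance infinity. For
  smaller degrees the comparison with the rational element 0, whose distance is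
  v(\<open>\<theta>\<close>), already rules out every candidate.\<close>

lemma next_degree:
  "(LEAST k. k > 1 \<and> (\<exists>\<epsilon>\<in>distances A F val \<theta> k. \<forall>\<delta>\<in>distances A F val \<theta> 1.
     val_less value_group \<delta> \<epsilon>)) = 4"
proof (rule Least_equality)
  have "val (\<theta> - b) \<noteq> None" if "degree_over A F b = 1" for b
    using that degree_over_theta by (auto simp: val_def)
  then have "\<forall>\<delta>\<in>distances A F val \<theta> 1. val_less value_group \<delta> None"
    by (auto simp: distances_theta val_less_def)
  moreover have "None \<in> distances A F val \<theta> 4"
    using theta_mem degree_over_theta by (auto simp: distances_theta val_def intro!: exI[of _ \<theta>])
  ultimately show "4 > (1::nat) \<and> (\<exists>\<epsilon>\<in>distances A F val \<theta> 4. \<forall>\<delta>\<in>distances A F val \<theta> 1.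
      val_less value_group \<delta> \<epsilon>)" by auto
next
  fix k :: nat
  assume "k > 1 \<and> (\<exists>\<epsilon>\<in>distances A F val \<theta> k. \<forall>\<delta>\<in>distances A F val \<theta> 1.
    val_less value_group \<delta> \<epsilon>)"
  then obtain b where b: "b \<in> K.algebraics" "degree_over A F b = k"
    "\<forall>\<delta>\<in>distances A F val \<theta> 1. val_less value_group \<delta> (val (\<theta> - b))"
    by (auto simp: distances_theta)
  have "0 \<in> K.algebraics" "degree_over A F 0 = 1"
    using K.S.zero_mem degree_over_rational[OF K.zero_mem] by auto
  then have "val \<theta> \<in> distances A F val \<theta> 1"
    unfolding distances_theta by force
  then show "4 \<le> k" using closer_to_theta[OF b(1)] b(2,3) by auto
qed

lemma depth_theta: "depth A F value_group val \<theta> = 1"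
  unfolding depth_def
proof (rule the_equality)
  show "\<exists>m. depth_degrees A F value_group val \<theta> 1 m"
    by (rule exI[of _ "\<lambda>i. if i = 0 then 1 else 4"])
      (simp add: depth_degrees_def degree_over_theta next_degree[unfolded One_nat_def])
next
  fix s assume "\<exists>m. depth_degrees A F value_group val \<theta> s m"
  then obtain m where m: "m 0 = 1" "m s = 4"
    "\<And>i. i < s \<Longrightarrow> m i < 4 \<and> m (Suc i) = (LEAST k. k > m i \<and>
      (\<exists>\<epsilon>\<in>distances A F val \<theta> k. \<forall>\<delta>\<in>distances A F val \<theta> (m i). val_less value_group \<delta> \<epsilon>))"
    by (auto simp: depth_degrees_def degree_over_theta)
  \<comment> \<open>Uniqueness of the length: the chain cannot stop at degree 1, and it cannot go
    past index 1, where the full degree 4 is reached.\<close>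
  have "s \<noteq> 0" using m(1,2) by (cases s) auto
  moreover have "m 1 = 4" if "0 < s"
    using conjunct2[OF m(3)[OF that]] unfolding m(1) next_degree by simp
  moreover have "m 1 < 4" if "1 < s"
    using conjunct1[OF m(3)[OF that]] .
  ultimately show "s = 1" by linarith
qed

text \<open>The depth of the extension is a minimum over generators, so \<open>\<theta>\<close>
  alone provides the bound.\<close>

lemma extension_depth_le: "extension_depth A F L value_group val \<le> 1"
  unfolding extension_depth_def
  by (rule Least_le, rule bexI[of _ \<theta>])
    (simp_all add: depth_theta theta_mem K.S.adjoin_eq theta_algebraic L_def)

section \<open>Two distinct ramification ideals\<close>

lemma ramification_set_iff:
  assumes "\<sigma> \<in> carrier G"
  shows "c \<in> ramification_set A L value_group val \<sigma> \<longleftrightarrow>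
    c \<in> L \<and> (\<exists>b\<in>L - {0}. \<exists>d\<in>V. c = d * ((\<sigma> b - b) / b))"
proof -
  have "(\<sigma> b \<ominus>\<^bsub>A\<^esub> b) \<otimes>\<^bsub>A\<^esub> inv\<^bsub>A\<^esub> b = (\<sigma> b - b) / b" if "b \<in> L - {0}" for b
  proof -
    have "\<sigma> b \<in> L"
      using assms that Bij_imp_funcset[of \<sigma> L] by (auto simp: mem_Gal_field_on)
    then show ?thesis
      using that L_subset_algebraics
      by (auto simp: K.S.a_minus_field_on K.S.m_inv_field_on subset_iff divide_inverse)
  qed
  then show ?thesis
    by (auto simp: ramification_set_def val_le_iff)
qed

lemma one_Gal: "\<one>\<^bsub>G\<^esub> = (\<lambda>x\<in>L. x)"
  by (simp add: Gal_def BijGroup_def)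

abbreviation \<tau> :: "complex \<Rightarrow> complex" where "\<tau> \<equiv> rotation (- 1)"

lemma tau_mem: "\<tau> \<in> carrier G"
  by (rule rotation_mem_Gal) (auto simp: K.uminus_mem K.one_mem)

lemma tau_tau: "\<tau> \<otimes>\<^bsub>G\<^esub> \<tau> = \<one>\<^bsub>G\<^esub>"
proof -
  have "compose L \<tau> \<tau> = (\<lambda>x\<in>L. x)"
    by (rule ext) (auto simp: compose_def rotation_rotation rotation_one K.uminus_mem K.one_mem)
  then show ?thesis
    using tau_mem unfolding one_Gal by (simp add: Gal_def BijGroup_def)
qed

lemma subgroup_tau: "subgroup {\<one>\<^bsub>G\<^esub>, \<tau>} G"
proof -
  have "inv\<^bsub>G\<^esub> \<tau> = \<tau>" using G.inv_equality[OF tau_tau tau_mem tau_mem] .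
  then show ?thesis
    using tau_mem tau_tau by (intro G.subgroupI) auto
qed

text \<open>Since \<open>\<tau>\<close> negates \<open>\<theta>\<close>, even terms of
  \<open>b\<close> cancel in the difference and odd ones are doubled. Each term is a multiple of
  \<open>b\<close>, so the difference is a multiple of \<open>2 * b\<close>.\<close>

lemma tau_minus_id_divisible:
  assumes "b \<in> L"
  shows "\<exists>c\<in>V. \<tau> b - b = 2 * c * b"
proof -
  obtain q where "q \<in> K.polys" "b = poly q \<theta>" using assms by (rule LE)
  then obtain r where r: "r \<in> K.polys" "Polynomial.degree r < 4" "b = poly r \<theta>"
    using reduce_degree theta_power by metis
  obtain c where c: "\<And>i. c i \<in> V" "\<And>i. poly.coeff r i * \<theta> ^ i = c i * b"
    using term_divisible_by_poly[OF r(1,2) conjugate_unit[OF theta_power]] r(3) by metis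
  have expand: "poly r t = (\<Sum>i<4. poly.coeff r i * t ^ i)" for t
    unfolding poly_altdef using r(2) by (intro sum.mono_neutral_left) (auto simp: not_le coeff_eq_0)
  have "\<tau> b - b = poly r (- \<theta>) - poly r \<theta>"
    using rotation_poly[OF r(1), of "- 1"] r(3) by simp
  also have "\<dots> = - 2 * (poly.coeff r 1 * \<theta> ^ 1 + poly.coeff r 3 * \<theta> ^ 3)"
    unfolding expand by (simp add: eval_nat_numeral)
  also have "\<dots> = 2 * (- (c 1 + c 3)) * b"
    unfolding c(2) by (simp add: algebra_simps)
  finally show ?thesis using c(1) uminus_mem add_mem by blast
qed

text \<open>The square of i - 1 is -2i, so its value is half of v(2). From i - 1 = 2d one gets 4 d^2
  = -2i, which exhibits \<open>d ^ 2 * i\<close> as the inverse of 2.\<close>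

lemma i_minus_one_nonmultiple: "d \<in> V \<Longrightarrow> \<i> - 1 \<noteq> 2 * d"
proof
  assume d: "d \<in> V" "\<i> - 1 = 2 * d"
  have square: "(2 * d) ^ 2 = - 2 * \<i>"
    unfolding d(2)[symmetric] by (simp add: power2_eq_square algebra_simps)
  have "2 * (d ^ 2 * \<i>) = (2 * d) ^ 2 * \<i> / 2" by (simp add: power2_eq_square)
  also have "\<dots> = 1" unfolding square by simp
  finally have "2 * (d ^ 2 * \<i>) = 1" .
  then have "inverse 2 = d ^ 2 * \<i>" by (metis inverse_unique)
  then show False
    using half_notin d(1) mult_mem power_mem units_mem[OF i_units] by metis
qed

lemma i_minus_one_notin: "\<i> - 1 \<notin> ramification_ideal A L value_group val {\<one>\<^bsub>G\<^esub>, \<tau>}"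
proof
  assume "\<i> - 1 \<in> ramification_ideal A L value_group val {\<one>\<^bsub>G\<^esub>, \<tau>}"
  then obtain \<sigma> where "\<sigma> = \<one>\<^bsub>G\<^esub> \<or> \<sigma> = \<tau>" "\<i> - 1 \<in> ramification_set A L value_group val \<sigma>"
    by (auto simp: ramification_ideal_def)
  moreover from this have "\<sigma> \<in> carrier G" using tau_mem G.one_closed by auto
  ultimately obtain b d where b: "b \<in> L" "b \<noteq> 0" "d \<in> V" "\<i> - 1 = d * ((\<sigma> b - b) / b)"
    by (auto simp: ramification_set_iff)
  have "\<exists>c\<in>V. \<sigma> b - b = 2 * c * b"
  proof (cases "\<sigma> = \<tau>")
    case True
    then show ?thesis using tau_minus_id_divisible[OF b(1)] by simp
  next
    case False
    \<comment> \<open>The identity belongs to the subgroup as well; its quotients are 0, of infinite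
      value.\<close>
    then have "\<sigma> b - b = 2 * 0 * b" using \<open>\<sigma> = \<one>\<^bsub>G\<^esub> \<or> \<sigma> = \<tau>\<close> b(1) by (simp add: one_Gal)
    then show ?thesis using zero_mem by blast
  qed
  then obtain c where "c \<in> V" "\<sigma> b - b = 2 * c * b" ..
  then have "\<i> - 1 = 2 * (d * c)" using b(2,4) by simp
  then show False using i_minus_one_nonmultiple[OF mult_mem] b(3) \<open>c \<in> V\<close> by blast
qed

lemma i_minus_one_mem: "\<i> - 1 \<in> ramification_ideal A L value_group val (carrier G)"
proof -
  have \<sigma>: "rotation \<i> \<in> carrier G"
    by (rule rotation_mem_Gal[OF i_mem_gaussian_rationals i_power_4])
  have "\<i> - 1 = 1 * ((rotation \<i> \<theta> - \<theta>) / \<theta>)"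
    using theta_nonzero by (simp add: rotation_theta[OF i_power_4] field_simps)
  moreover have "\<i> - 1 \<in> L"
    using F_subset_L i_mem_gaussian_rationals L.one_mem L.diff_mem by blast
  ultimately have "\<i> - 1 \<in> ramification_set A L value_group val (rotation \<i>)"
    unfolding ramification_set_iff[OF \<sigma>] using theta_mem_L theta_nonzero one_mem by blast
  with \<sigma> show ?thesis by (auto simp: ramification_ideal_def)
qed

text \<open>The element i - 1 separates the ideals of the two subgroups. Finiteness of
  \<open>Ram\<close>, inherited from the Galois group, turns this into a bound on
  \<open>card\<close>.\<close>

lemma card_Ram: "card (Ram A F L value_group val) > 1"
proof -
  have "Ram A F L value_group val \<subseteq> ramification_ideal A L value_group val ` Pow (carrier G)"
    using subgroup.subset by (fastforce simp: Ram_def)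
  then have "finite (Ram A F L value_group val)"
    by (rule finite_subset) (simp add: finite_Gal)
  moreover have "\<tau> \<theta> \<noteq> \<one>\<^bsub>G\<^esub> \<theta>"
    using rotation_theta[of "- 1"] theta_mem_L theta_nonzero by (simp add: one_Gal)
  then have "\<tau> \<noteq> \<one>\<^bsub>G\<^esub>" by auto
  then have nontriv: "{\<one>\<^bsub>G\<^esub>, \<tau>} \<noteq> {\<one>\<^bsub>G\<^esub>}" "carrier G \<noteq> {\<one>\<^bsub>G\<^esub>}"
    using tau_mem by auto
  let ?I = "ramification_ideal A L value_group val"
  have "?I {\<one>\<^bsub>G\<^esub>, \<tau>} \<in> Ram A F L value_group val" "?I (carrier G) \<in> Ram A F L value_group val"
    unfolding Ram_def using subgroup_tau G.subgroup_self nontriv by blast+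
  moreover have "?I {\<one>\<^bsub>G\<^esub>, \<tau>} \<noteq> ?I (carrier G)"
    using i_minus_one_notin i_minus_one_mem by metis
  ultimately show ?thesis
    by (metis One_nat_def card_le_Suc0_iff_eq not_less)
qed

end

theorem corollary6p9:
  shows "\<exists>(A :: complex ring) K L (\<Gamma> :: complex set ordered_group) v.
           finite_galois_valued_extension A K L \<Gamma> v \<and>
           extension_depth A K L \<Gamma> v < card (Ram A K L \<Gamma> v)"
proof -
  have "inverse 2 \<notin> (\<int> :: complex set)"
  proof
    assume "inverse 2 \<in> (\<int> :: complex set)"
    then obtain k :: int where "inverse 2 = (of_int k :: complex)" by (auto elim: Ints_cases)
    then have "of_int (2 * k) = (1 :: complex)" by (simp add: field_simps)
    then have "2 * k = 1" by (metis of_int_eq_1_iff)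
    then show False by presburger
  qed
  \<comment> \<open>The integers with c = 2 start the construction: 1/2 stays outside
    \<open>V\<close>, so 2 has positive value on all of the complex numbers.\<close>
  then obtain V :: "complex set" where V: "valuation_ring V" "inverse 2 \<notin> V"
    using exists_valuation_ring[OF unital_subring_Ints Ints_numeral] by blast
  have "Polynomial.degree [:- (1 + \<i>), 0, 0, 0, 1:] > 0" by simp
  then obtain \<theta> where "poly [:- (1 + \<i>), 0, 0, 0, 1:] \<theta> = 0"
    using alg_closed_imp_poly_has_root by blast
  then have "\<theta> ^ 4 = 1 + \<i>" by (simp add: eval_nat_numeral algebra_simps)
  with V have Q: "quartic_radical V \<theta>"
    by (simp add: quartic_radical_def quartic_radical_axioms_def)
  from quartic_radical.finite_galois_valued_extension_L[OF Q]
    quartic_radical.extension_depth_le[OF Q] quartic_radical.card_Ram[OF Q]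
  show ?thesis by (meson le_less_trans)
qed

end
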